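(* Let $d\ge 1$ be an integer and let $c \geq 2d$ be a real number. Let $$r=r(c)=\sqrt{(4d^2-2d)(c-1)\log\left(\frac{c}{c-1}\right)},$$ let $B_r^{2d}=\{X\in\mathbb R^{2d}:\|X\|\le r\}$ be the closed Euclidean ball of radius $r$ centered at the origin, and let $\varPi_{2d}=\{x=(x_1,\ldots,x_{2d})\in\mathbb R^{2d}:\sum_{i=1}^{2d}x_i=0\}$. Let $\mathcal G:B_r^{2d}\cap\varPi_{2d}\to[0,1]$ be the function $$\mathcal G(X)=\left(\pi^{1/2-d}\,2^{3/2-2d}\,d^{1-d}\right)\left[\left(\frac{c}{c-1}\right)^{d-1/2}\exp\left(-\frac{c\|X\|^2}{4d(c-1)}\right)-\exp\left(-\frac{\|X\|^2}{4d}\right)\right].$$ Then, as $n\to\infty$ along positive integers $n$ for which $cn$ is an integer multiple of $2d$, $$d_n(cn)=\int_{B_r^{2d}\cap\varPi_{2d}}\mathcal G(X)\,dX+\mathcal O\left(\frac{1}{\sqrt n}\right).$$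
   Context: Here $\|\cdot\|$ is the Euclidean norm. On the hyperplane $\varPi_{2d}$, $dX$ denotes Lebesgue measure in the first $2d-1$ coordinates: $\int_{B_r^{2d}\cap\varPi_{2d}}\mathcal G(X)\,dX$ means $\int_W \mathcal G\left(x_1,\ldots,x_{2d-1},-\sum_{i=1}^{2d-1}x_i\right)dx_1\cdots dx_{2d-1}$, where $W=\{(x_1,\ldots,x_{2d-1})\in\mathbb R^{2d-1}: (x_1,\ldots,x_{2d-1},-\sum_{i=1}^{2d-1} x_i)\in B_r^{2d}\}$ (not the $(2d-1)$-dimensional surface measure). Definition of $d_n(N)$. Let $N=2dK$ with $K$ a positive integer and let $1\le n<N$. Let $\Lambda_N=\{1,\ldots,N\}$ (a deck of $N$ cards) and let $S_N$ be the set of permutations of $\Lambda_N$ with the uniform probability $\mathbb Q_N$. Let $\varphi:\Lambda_N\to\{0,1,\ldots,2d-1\}$ map $j$ to its residue modulo $2d$ (the suit of card $j$; each suit has exactly $K$ cards). Let $\Omega_n=\{0,1,\ldots,2d-1\}^n$ and let $\mathbb P_n$ be the uniform probability on $\Omega_n$. Define $X:S_N\to\Omega_n$ by $X(\sigma)=(\varphi(\sigma(1)),\ldots,\varphi(\sigma(n)))$ and $\mu_X(\omega)=\mathbb Q_N(X=\omega)$ for $\omega\in\Omega_n$. Then $d_n(N)$ is the total variation distance between $\mu_X$ and $\mathbb P_n$: $$d_n(N)=\sum_{\omega\in\Omega_n}\left[\mu_X(\omega)-(2d)^{-n}\right]^+,\qquad [t]^+=\max(t,0).$$ The notation $a_n=\mathcal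 O(b_n)$ means that there is a constant $C>0$ (which may depend on $c$ and $d$) such that $|a_n|\le C|b_n|$ for all sufficiently large $n$ (among the admissible $n$). *)

theory Defs
  imports "HOL-Probability.Probability" "HOL-Library.Landau_Symbols"
begin

text \<open>
  Card shuffling. The deck is \<open>{1..N}\<close>, the suit of card \<open>j\<close> is \<open>j mod (2 * d)\<close>, and elements of
  \<open>\<Omega>\<^sub>n\<close> are extensional functions on \<open>{1..n}\<close>.
\<close>

definition suit :: "nat \<Rightarrow> nat \<Rightarrow> nat"
  where "suit d j = j mod (2 * d)"

definition suit_words :: "nat \<Rightarrow> nat \<Rightarrow> (nat \<Rightarrow> nat) set"
  where "suit_words d n = ({1..n} \<rightarrow>\<^sub>E {0..<2 * d})"

definition shuffle_pmf :: "nat \<Rightarrow> (nat \<Rightarrow> nat) pmf"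
  where "shuffle_pmf N = pmf_of_set {\<sigma>. \<sigma> permutes {1..N}}"

definition drawn_suits :: "nat \<Rightarrow> nat \<Rightarrow> (nat \<Rightarrow> nat) \<Rightarrow> (nat \<Rightarrow> nat)"
  where "drawn_suits d n \<sigma> = (\<lambda>i\<in>{1..n}. suit d (\<sigma> i))"

definition drawn_suits_pmf :: "nat \<Rightarrow> nat \<Rightarrow> nat \<Rightarrow> (nat \<Rightarrow> nat) pmf"
  where "drawn_suits_pmf d n N = map_pmf (drawn_suits d n) (shuffle_pmf N)"

text \<open>The quantity \<open>d\<^sub>n(N)\<close>; it is meant for \<open>2 * d dvd N\<close> and \<open>1 \<le> n < N\<close>.\<close>

definition tv_dist :: "nat \<Rightarrow> nat \<Rightarrow> nat \<Rightarrow> real"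
  where "tv_dist d n N =
    (\<Sum>\<omega>\<in>suit_words d n. max (pmf (drawn_suits_pmf d n N) \<omega> - 1 / real (2 * d) ^ n) 0)"

text \<open>
  Since the dimension \<open>2 * d\<close> depends on the natural number \<open>d\<close>, points of \<open>\<real>\<^sup>2\<^sup>d\<close> are extensional
  functions on \<open>{1..2 * d}\<close>; their Euclidean norm is \<^const>\<open>L2_set\<close>.
\<close>

definition closed_ball :: "nat \<Rightarrow> real \<Rightarrow> (nat \<Rightarrow> real) set"
  where "closed_ball m r = {X \<in> {1..m} \<rightarrow>\<^sub>E UNIV. L2_set X {1..m} \<le> r}"

definition zero_sum_plane :: "nat \<Rightarrow> (nat \<Rightarrow> real) set"
  where "zero_sum_plane m = {X \<in> {1..m} \<rightarrow>\<^sub>E UNIV. (\<Sum>i=1..m. X i) = 0}"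

text \<open>
  Integration over a subset of the hyperplane is with respect to Lebesgue measure in the first
  \<open>m - 1\<close> coordinates, the last coordinate being minus their sum. This is not the surface measure.
\<close>

definition complete_point :: "nat \<Rightarrow> (nat \<Rightarrow> real) \<Rightarrow> (nat \<Rightarrow> real)"
  where "complete_point m x = x(m := - (\<Sum>i\<in>{1..<m}. x i))"

definition plane_integral :: "nat \<Rightarrow> (nat \<Rightarrow> real) set \<Rightarrow> ((nat \<Rightarrow> real) \<Rightarrow> real) \<Rightarrow> real"
  where "plane_integral m A f =
    (let M = (\<Pi>\<^sub>M i\<in>{1..<m}. lborel) in
      LINT x:{x \<in> space M. complete_point m x \<in> A}|M. f (complete_point m x))"

definition radius :: "nat \<Rightarrow> real \<Rightarrow> real"
  where "radius d c = sqrt ((4 * real d ^ 2 - 2 * real d) * (c - 1) * ln (c / (c - 1)))"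

definition gauss_diff :: "nat \<Rightarrow> real \<Rightarrow> (nat \<Rightarrow> real) \<Rightarrow> real"
  where "gauss_diff d c X =
    (pi powr (1 / 2 - real d) * 2 powr (3 / 2 - 2 * real d) * real d powr (1 - real d)) *
    ((c / (c - 1)) powr (real d - 1 / 2)
        * exp (- (c * (L2_set X {1..2 * d})\<^sup>2 / (4 * real d * (c - 1))))
      - exp (- ((L2_set X {1..2 * d})\<^sup>2 / (4 * real d))))"

text \<open>The function is \<open>[0, 1]\<close>-valued on the region of integration.\<close>

lemma gauss_diff_range:
  assumes d: "d \<ge> 1" and c: "c \<ge> 2 * real d"
    and X: "X \<in> closed_ball (2 * d) (radius d c) \<inter> zero_sum_plane (2 * d)"
  shows "gauss_diff d c X \<in> {0..1}"
proof -
  define s where "s = (L2_set X {1..2 * d})\<^sup>2"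
  define L where "L = ln (c / (c - 1))"
  define a where "a = (real d - 1 / 2) * L - c * s / (4 * real d * (c - 1))"
  define b where "b = - (s / (4 * real d))"
  define P where "P = pi powr (1 / 2 - real d) * 2 powr (3 / 2 - 2 * real d) * real d powr (1 - real d)"
  have d': "real d \<ge> 1" and c1: "c - 1 \<ge> 1" "c > 1" using d c by auto
  have s0: "s \<ge> 0" by (simp add: s_def)
  have L0: "L \<ge> 0" using c1 by (simp add: L_def)
  have "L = ln (1 + 1 / (c - 1))" using c1 by (simp add: L_def field_simps)
  also have "\<dots> \<le> 1 / (c - 1)" using c1 by (intro ln_add_one_self_le_self) auto
  finally have L1: "(c - 1) * L \<le> 1" using c1 by (simp add: field_simps)
  have "L2_set X {1..2 * d} \<le> radius d c" using X by (simp add: closed_ball_def)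
  then have "s \<le> (radius d c)\<^sup>2" unfolding s_def by (intro power_mono) auto
  also have "(radius d c)\<^sup>2 = (4 * real d ^ 2 - 2 * real d) * (c - 1) * L"
    using d' c1 L0 unfolding radius_def L_def[symmetric]
    by (intro real_sqrt_pow2 mult_nonneg_nonneg) (auto simp: power2_eq_square algebra_simps)
  finally have "s / (4 * real d * (c - 1)) \<le>
      (4 * real d ^ 2 - 2 * real d) * (c - 1) * L / (4 * real d * (c - 1))"
    using d' c1 by (intro divide_right_mono) auto
  also have "\<dots> = (real d - 1 / 2) * L"
    using d' c1 by (simp add: field_simps power2_eq_square)
  finally have sL: "s / (4 * real d * (c - 1)) \<le> (real d - 1 / 2) * L" .
  have split: "c * s / (4 * real d * (c - 1)) = s / (4 * real d * (c - 1)) + s / (4 * real d)"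
    using d' c1 by (simp add: field_simps)
  have ba: "b \<le> a" using sL split by (simp add: a_def b_def)
  have "(real d - 1 / 2) * L \<le> (c - 1) * L"
    using L0 c d' by (intro mult_right_mono) auto
  moreover have "(real d - 1 / 2) * L * 2 \<le> (c - 1) * L"
    using mult_right_mono[OF _ L0, of "(real d - 1 / 2) * 2" "c - 1"] c by (simp add: algebra_simps)
  moreover have "c * s / (4 * real d * (c - 1)) \<ge> 0" using s0 d' c1 by auto
  ultimately have a1: "a \<le> 1 / 2" using L1 unfolding a_def by linarith
  have eab: "exp a \<le> exp (1/2)" using a1 by simp
  have e2: "exp (1/2 :: real) \<le> 2"
  proof -
    have "exp (1/2 :: real) ^ 2 = exp 1" by (simp flip: exp_of_nat_mult)
    also have "\<dots> \<le> 2 ^ 2" using exp_le by simp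
    finally show ?thesis by (rule power2_le_imp_le) auto
  qed
  have p1: "pi powr (1 / 2 - real d) \<le> pi powr (- (1/2))"
    using d' pi_gt3 by (intro powr_mono) auto
  have p2: "2 powr (3 / 2 - 2 * real d) \<le> (2::real) powr (- (1/2))"
    using d' by (intro powr_mono) auto
  have p3: "real d powr (1 - real d) \<le> real d powr 0"
    using d' by (intro powr_mono) auto
  have "P \<le> pi powr (- (1/2)) * 2 powr (- (1/2)) * 1"
    unfolding P_def using p1 p2 p3 d' by (intro mult_mono) auto
  also have "\<dots> = (2 * pi) powr (- (1/2))" by (simp add: powr_mult)
  also have "\<dots> \<le> 4 powr (- (1/2))" using pi_gt3 by (intro powr_mono2') auto
  also have "(4::real) powr (- (1/2)) = 1 / 2"
    by (simp add: powr_minus powr_half_sqrt)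
  finally have P2: "P \<le> 1 / 2" .
  have P0: "P \<ge> 0" by (simp add: P_def)
  have "(c / (c - 1)) powr (real d - 1 / 2) = exp ((real d - 1 / 2) * L)"
    using c1 by (simp add: powr_def L_def)
  then have "exp a = (c / (c - 1)) powr (real d - 1 / 2) * exp (- (c * s / (4 * real d * (c - 1))))"
    unfolding a_def by (simp only: diff_conv_add_uminus exp_add)
  then have "gauss_diff d c X = P * (exp a - exp b)"
    by (simp only: gauss_diff_def P_def b_def s_def)
  moreover have "P * (exp a - exp b) \<ge> 0" using P0 ba by simp
  moreover have "exp a - exp b \<le> 2"
    using eab e2 exp_gt_zero[of b] by linarith
  then have "P * (exp a - exp b) \<le> (1/2) * 2"
    using P0 P2 ba by (intro mult_mono) auto
  ultimately show ?thesis by simp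
qed

text \<open>The positive integers \<open>n\<close> for which \<open>c * n\<close> is an integer multiple of \<open>2 * d\<close>.\<close>

definition admissible :: "nat \<Rightarrow> real \<Rightarrow> nat set"
  where "admissible d c = {n. n > 0 \<and> (\<exists>k::int. c * real n = real_of_int k * (2 * real d))}"

end

theory Submission
  imports Defs "HOL-Combinatorics.Multiset_Permutations"
begin

text \<open>
  Write \<open>m = 2 d\<close> for the number of suits, \<open>N = m K = c n\<close> for the size of the deck, and
  \<open>X\<^sub>j = (m b\<^sub>j - n) / sqrt n\<close> for the rescaled number \<open>b\<^sub>j\<close> of drawn cards of suit \<open>j\<close>. The
  probability of a word depends only on its suit counts \<open>b\<close>, so \<open>d\<^sub>n(N)\<close> is the sum over all count vectors of
  the positive part of \<open>H(b) - M(b)\<close>, where \<open>H\<close> is the multivariate hypergeometric and \<open>M\<close> the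
  multinomial law (\<open>tv_dist_counts\<close>).

  The count vectors form a lattice of spacing \<open>m / sqrt n\<close> in the hyperplane. By Stirling's formula
  (\<open>stirling_ln_fact\<close>), as long as \<open>\<parallel>X\<parallel>\<close> stays bounded, \<open>H\<close> and \<open>M\<close> divided by the volume
  \<open>(m / sqrt n)\<^bsup>m - 1\<^esup>\<close> of a lattice cell are the two Gaussian densities whose difference is \<open>\<G>(X)\<close>, up to errors of
  order \<open>1 / sqrt n\<close> (\<open>local_limit\<close>). The draws without replacement have the smaller variance, so \<open>\<G>\<close>
  is nonnegative exactly on the ball of radius \<open>r\<close>, and the integral of \<open>\<G>\<close> over the ball is that
  of its positive part over the whole hyperplane (\<open>plane_integral_eq_profile\<close>).

  Far from the origin the two laws are compared pointwise: the logarithm of \<open>H / M\<close> is bounded above, uniformly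
  in \<open>n\<close>, by a constant minus a positive multiple of \<open>\<parallel>X\<parallel>\<^sup>2\<close>, since falling factorials are log-concave
  (\<open>ln_mass_ratio_upper\<close>). So \<open>H \<le> M\<close> outside a fixed ball, and there both the positive part of \<open>H - M\<close>
  and that of \<open>\<G>\<close> vanish. Hence the approximation is uniform over all count vectors (\<open>uniform_local_limit\<close>).

  It follows that \<open>d\<^sub>n(N)\<close> is the integral of a step function, constant on lattice cells, that differs from
  the Lipschitz function \<open>max \<G> 0\<close> by at most a constant times \<open>1 / sqrt n\<close>, and only within a fixed
  cube (\<open>step_function_pointwise\<close>). Integrating this over the cube gives the theorem.
\<close>

section \<open>Stirling's formula with an error bound\<close>

text \<open>
  Integrate the derivative \<open>z\<^sup>2 / (1 + z)\<close> of the difference, which is at most \<open>2 u\<^sup>2\<close> in absolute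
  value on the segment from \<open>0\<close> to \<open>u\<close>.
\<close>

lemma ln_one_plus_cubic_error:
  fixes u :: real
  assumes u: "u \<ge> - (1/2)"
  shows "\<bar>ln (1 + u) - u + u\<^sup>2 / 2\<bar> \<le> 2 * \<bar>u\<bar> ^ 3"
proof -
  define S where "S = closed_segment 0 u"
  have S: "z \<ge> - (1/2) \<and> \<bar>z\<bar> \<le> \<bar>u\<bar>" if "z \<in> S" for z
    using that u by (auto simp: S_def closed_segment_eq_real_ivl split: if_splits)
  have "norm ((ln (1 + u) - u + u\<^sup>2 / 2) - (ln (1 + 0) - 0 + 0\<^sup>2 / 2)) \<le> (2 * u\<^sup>2) * norm (u - 0)"
  proof (rule field_differentiable_bound[where S = S and f' = "\<lambda>z. z\<^sup>2 / (1 + z)"])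
    fix z assume z: "z \<in> S"
    show "((\<lambda>x. ln (1 + x) - x + x\<^sup>2 / 2) has_field_derivative z\<^sup>2 / (1 + z)) (at z within S)"
      using S[OF z] by (auto intro!: derivative_eq_intros simp: field_simps power2_eq_square)
    have "1 * z\<^sup>2 \<le> (2 + 2 * z) * u\<^sup>2" using S[OF z]
      by (intro mult_mono) (auto simp: abs_le_square_iff)
    then show "norm (z\<^sup>2 / (1 + z)) \<le> 2 * u\<^sup>2"
      using S[OF z] by (simp add: field_simps)
  qed (auto simp: S_def)
  then show ?thesis by (simp add: power3_eq_cube power2_eq_square abs_mult)
qed

text \<open>
  The quadratic term of \<open>x ln x\<close> at \<open>1\<close> is what produces the Gaussian exponents; the cubic
  remainder, at distance \<open>1 / sqrt n\<close> and multiplied by \<open>n\<close>, is what produces the rate \<open>1 / sqrt n\<close>.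
\<close>

lemma xlnx_quadratic_error:
  fixes u :: real
  assumes u: "\<bar>u\<bar> \<le> 1/2"
  shows "\<bar>(1 + u) * ln (1 + u) - u - u\<^sup>2 / 2\<bar> \<le> 2 * \<bar>u\<bar> ^ 3"
proof -
  define S where "S = closed_segment 0 u"
  have S: "\<bar>z\<bar> \<le> 1/2 \<and> \<bar>z\<bar> \<le> \<bar>u\<bar>" if "z \<in> S" for z
    using that u by (auto simp: S_def closed_segment_eq_real_ivl split: if_splits)
  have "norm (((1 + u) * ln (1 + u) - u - u\<^sup>2 / 2) - ((1 + 0) * ln (1 + 0) - 0 - 0\<^sup>2 / 2))
        \<le> (2 * u\<^sup>2) * norm (u - 0)"
  proof (rule field_differentiable_bound[where S = S and f' = "\<lambda>z. ln (1 + z) - z"])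
    fix z assume z: "z \<in> S"
    show "((\<lambda>x. (1 + x) * ln (1 + x) - x - x\<^sup>2 / 2) has_field_derivative ln (1 + z) - z) (at z within S)"
    proof -
      have "1 + z > 0" using S[OF z] by auto
      then show ?thesis by (auto intro!: derivative_eq_intros simp: add.commute)
    qed
    have "\<bar>ln (1 + z) - z\<bar> \<le> 2 * z\<^sup>2"
      using S[OF z] by (intro abs_ln_one_plus_x_minus_x_bound) auto
    also have "\<dots> \<le> 2 * u\<^sup>2" using S[OF z] by (simp add: abs_le_square_iff)
    finally show "norm (ln (1 + z) - z) \<le> 2 * u\<^sup>2" by simp
  qed (auto simp: S_def)
  then show ?thesis by (simp add: power3_eq_cube power2_eq_square abs_mult)
qed

definition stirling_main :: "real \<Rightarrow> real"
  where "stirling_main y = y * ln y - y + ln (2 * pi * y) / 2"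

text \<open>
  The increments of \<open>s\<close> are of order \<open>1 / k\<^sup>2\<close>; bounding them by a telescoping difference makes
  \<open>s k \<plusminus> 8 / k\<close> two nested monotone sequences, so that their common limit is
  approached with error \<open>8 / k\<close>.
\<close>

lemma stirling_step:
  assumes n: "n > 0"
  defines "s \<equiv> \<lambda>k. ln (fact k) - ((real k + 1/2) * ln (real k) - real k)"
  shows "\<bar>s n - s (Suc n)\<bar> \<le> 8 / real n - 8 / real (Suc n)"
proof -
  define x where "x = real n"
  define u where "u = 1 / x"
  have x: "x \<ge> 1" using n by (simp add: x_def)
  have u: "0 < u" "u \<le> 1" using x by (auto simp: u_def)
  define e where "e = ln (1 + u) - u + u\<^sup>2 / 2"
  have e: "\<bar>e\<bar> \<le> 2 * u ^ 3" using ln_one_plus_cubic_error[of u] u by (simp add: e_def)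
  have ux: "u * x = 1" using x by (simp add: u_def)
  have "1 + u = (x + 1) / x" using x by (simp add: u_def field_simps)
  then have "ln (1 + u) = ln (x + 1) - ln x" using x by (simp add: ln_div)
  moreover have "ln (fact (Suc n)) = ln (x + 1) + ln (fact n :: real)"
    using x by (simp add: ln_mult x_def add.commute del: of_nat_Suc)
  moreover have "real (Suc n) = x + 1" by (simp add: x_def)
  ultimately have "s n - s (Suc n) = (x + 1/2) * ln (1 + u) - 1"
    by (simp only: s_def x_def[symmetric]) (simp add: algebra_simps)
  also have "\<dots> = (x + 1/2) * (e + u - u\<^sup>2 / 2) - 1" by (simp add: e_def)
  also have "\<dots> = (x + 1/2) * e + (u * x) - (u * x) * u / 2 + u / 2 - u\<^sup>2/4 - 1"
    by (simp add: field_simps power2_eq_square)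
  also have "\<dots> = (x + 1/2) * e - u\<^sup>2/4" by (simp add: ux)
  finally have eq: "s n - s (Suc n) = (x + 1/2) * e - u\<^sup>2/4" .
  have "\<bar>(x + 1/2) * e\<bar> \<le> (3/2 * x) * (2 * u ^ 3)"
    using e x by (simp only: abs_mult, intro mult_mono) auto
  also have "\<dots> = 3 * u\<^sup>2 * (u * x)" by (simp add: power2_eq_square power3_eq_cube)
  also have "\<dots> = 3 * u\<^sup>2" by (simp add: ux)
  finally have "\<bar>s n - s (Suc n)\<bar> \<le> 4 * u\<^sup>2" unfolding eq by (auto simp: abs_le_iff)
  also have "4 * u\<^sup>2 = 8 / (x * (2 * x))" using x by (simp add: u_def power2_eq_square)
  also have "\<dots> \<le> 8 / (x * (x + 1))" using x by (intro divide_left_mono mult_left_mono) auto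
  also have "\<dots> = 8 / x - 8 / (x + 1)" using x by (simp add: field_simps)
  finally show ?thesis by (simp add: x_def add.commute)
qed

lemma wallis_factorial:
  "(\<Prod>k=1..n. (4 * real k ^ 2) / (4 * real k ^ 2 - 1))
     = 16 ^ n * fact n ^ 4 / ((fact (2 * n))\<^sup>2 * real (2 * n + 1))"
proof (induction n)
  case (Suc n)
  define x where "x = real n"
  have x: "x \<ge> 0" by (simp add: x_def)
  have f: "fact (2 * Suc n) = (2 * x + 2) * (2 * x + 1) * (fact (2 * n) :: real)"
    by (simp add: x_def algebra_simps)
  have f': "fact (Suc n) = (x + 1) * (fact n :: real)" by (simp add: x_def)
  have q: "4 * real (Suc n) ^ 2 - 1 = (2 * x + 1) * (2 * x + 3)"
    by (simp add: x_def power2_eq_square algebra_simps)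
  have nz: "2 * x + 1 \<noteq> 0" "2 * x + 3 \<noteq> 0" "x + 1 \<noteq> 0" "2 * x + 2 \<noteq> 0" using x by auto
  have "(\<Prod>k=1..Suc n. (4 * real k ^ 2) / (4 * real k ^ 2 - 1))
     = 16 ^ n * fact n ^ 4 / ((fact (2 * n))\<^sup>2 * (2 * x + 1)) * ((4 * (x + 1)^2) / ((2 * x + 1) * (2 * x + 3)))"
    by (simp only: prod.nat_ivl_Suc' Suc.IH q) (simp add: Suc.IH x_def algebra_simps)
  also have "\<dots> = 16 ^ Suc n * ((x + 1) * fact n) ^ 4 /
      (((2 * x + 2) * (2 * x + 1) * fact (2 * n))\<^sup>2 * (2 * x + 3))"
    using nz by (simp add: divide_simps) (simp add: algebra_simps power_mult_distrib power2_eq_square power4_eq_xxxx)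
  finally show ?case unfolding f f' by (simp add: x_def algebra_simps)
qed simp

text \<open>
  Convergence and its rate come from nested sequences;
  the limit is identified by writing Wallis' product with factorials, where it becomes
  \<open>4 s(n) - 2 s(2 n)\<close> up to explicit terms, hence twice the limit.
\<close>

theorem stirling_ln_fact:
  assumes n: "n > 0"
  shows "\<bar>ln (fact n) - stirling_main (real n)\<bar> \<le> 8 / real n"
proof -
  define s where "s = (\<lambda>k. ln (fact k) - ((real k + 1/2) * ln (real k) - real k))"
  define lo where "lo = (\<lambda>k. s (Suc k) - 8 / real (Suc k))"
  define hi where "hi = (\<lambda>k. s (Suc k) + 8 / real (Suc k))"
  have step: "\<bar>s (Suc k) - s (Suc (Suc k))\<bar> \<le> 8 / real (Suc k) - 8 / real (Suc (Suc k))" for k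
    unfolding s_def by (rule stirling_step) simp
  have "\<exists>l. ((\<forall>k. lo k \<le> l) \<and> lo \<longlonglongrightarrow> l) \<and> ((\<forall>k. l \<le> hi k) \<and> hi \<longlonglongrightarrow> l)"
  proof (rule nested_sequence_unique)
    show "\<forall>k. lo k \<le> lo (Suc k)" unfolding lo_def using step by (smt (verit))
    show "\<forall>k. hi (Suc k) \<le> hi k" unfolding hi_def using step by (smt (verit))
    show "\<forall>k. lo k \<le> hi k" by (simp add: lo_def hi_def)
    have "(\<lambda>k. - 16 * inverse (real (Suc k))) \<longlonglongrightarrow> - 16 * 0"
      by (intro tendsto_intros LIMSEQ_inverse_real_of_nat)
    then show "(\<lambda>k. lo k - hi k) \<longlonglongrightarrow> 0" by (simp add: lo_def hi_def inverse_eq_divide)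
  qed
  then obtain l where l: "\<And>k. lo k \<le> l" "\<And>k. l \<le> hi k" "lo \<longlonglongrightarrow> l" by blast
  have sl: "\<bar>s k - l\<bar> \<le> 8 / real k" if "k > 0" for k
    using l(1)[of "k - 1"] l(2)[of "k - 1"] that by (simp add: lo_def hi_def)
  have lim0: "(\<lambda>k. s k - l) \<longlonglongrightarrow> 0"
  proof (rule Lim_null_comparison)
    show "\<forall>\<^sub>F k in sequentially. norm (s k - l) \<le> 8 * inverse (real k)"
      using eventually_gt_at_top[of 0] by eventually_elim (use sl in \<open>simp add: field_simps\<close>)
    show "(\<lambda>k. 8 * inverse (real k)) \<longlonglongrightarrow> 0"
      using tendsto_mult[OF tendsto_const[of 8] lim_inverse_n[where 'a = real]] by simp
  qed
  have sl': "s \<longlonglongrightarrow> l" using tendsto_add[OF lim0 tendsto_const[of l]] by simp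
  have "filterlim (\<lambda>k::nat. 2 * k) at_top at_top"
    by (rule filterlim_subseq) (simp add: strict_mono_def)
  then have s2: "(\<lambda>k. s (2 * k)) \<longlonglongrightarrow> l" by (rule filterlim_compose[OF sl'])
  have W: "ln (\<Prod>k=1..n. (4 * real k ^ 2) / (4 * real k ^ 2 - 1))
      = 4 * s n - 2 * s (2 * n) - ln 2 - ln (2 + inverse (real n))" if "n > 0" for n :: nat
  proof -
    have a: "ln (2 + inverse (real n)) = ln (real (2 * n + 1)) - ln (real n)"
    proof -
      have "2 + inverse (real n) = real (2 * n + 1) / real n"
        using that by (simp add: field_simps)
      then show ?thesis using that by (simp add: ln_div)
    qed
    have b: "ln (real (2 * n)) = ln 2 + ln (real n)" using that by (simp add: ln_mult)
    have "ln (16::real) = ln (2 ^ 4)" by simp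
    also have "\<dots> = 4 * ln 2" by (subst ln_realpow) auto
    finally have c: "ln (16::real) = 4 * ln 2" .
    have p: "fact (2 * n) > (0::real)" by simp
    have "ln (\<Prod>k=1..n. (4 * real k ^ 2) / (4 * real k ^ 2 - 1))
       = real n * ln 16 + 4 * ln (fact n) - (2 * ln (fact (2 * n)) + ln (real (2 * n + 1)))"
      unfolding wallis_factorial using p
      by (subst ln_div ln_mult ln_realpow; simp)+
    then show ?thesis unfolding a s_def b c by (simp add: algebra_simps)
  qed
  have "(\<lambda>n. 4 * s n - 2 * s (2 * n) - ln 2 - ln (2 + inverse (real n)))
      \<longlonglongrightarrow> 4 * l - 2 * l - ln 2 - ln (2 + 0)"
    by (intro tendsto_intros sl' s2 lim_inverse_n) auto
  moreover have "(\<lambda>n. ln (\<Prod>k=1..n. (4 * real k ^ 2) / (4 * real k ^ 2 - 1))) \<longlonglongrightarrow> ln (pi / 2)"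
    by (intro tendsto_ln wallis) auto
  moreover have "\<forall>\<^sub>F n in sequentially. 4 * s n - 2 * s (2 * n) - ln 2 - ln (2 + inverse (real n))
        = ln (\<Prod>k=1..n. (4 * real k ^ 2) / (4 * real k ^ 2 - 1))"
    using eventually_gt_at_top[of 0] by eventually_elim (use W in simp)
  ultimately have lim: "(\<lambda>n. ln (\<Prod>k=1..n. (4 * real k ^ 2) / (4 * real k ^ 2 - 1)))
      \<longlonglongrightarrow> 4 * l - 2 * l - ln 2 - ln (2 + 0)"
    and lim': "(\<lambda>n. ln (\<Prod>k=1..n. (4 * real k ^ 2) / (4 * real k ^ 2 - 1))) \<longlonglongrightarrow> ln (pi / 2)"
    by (auto intro: Lim_transform_eventually)
  have "4 * l - 2 * l - ln 2 - ln (2 + 0) = ln (pi / 2)"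
    by (rule LIMSEQ_unique[OF lim lim'])
  then have "l = (ln 2 + ln pi) / 2" by (simp add: ln_div)
  then show ?thesis
    using sl[OF n] n by (simp add: s_def stirling_main_def ln_mult field_simps)
qed

text \<open>
  With \<open>q = y (1 + u)\<close> the difference of the two Stirling approximations is exactly
  \<open>y ((1 + u) ln (1 + u) - u - u\<^sup>2 / 2) + ln (1 + u) / 2\<close>. In the bound, the three terms are Stirling's
  error, the cubic remainder, and the change of the factor \<open>sqrt (2 \<pi> y)\<close>.
\<close>

lemma ln_fact_expansion_bound:
  fixes q :: nat and y :: real
  assumes y: "y > 0" and h: "\<bar>real q - y\<bar> \<le> y / 2"
  shows "\<bar>ln (fact q) - (stirling_main y + (real q - y) * ln y + (real q - y)\<^sup>2 / (2 * y))\<bar>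
     \<le> 16 / y + 2 * \<bar>real q - y\<bar> ^ 3 / y\<^sup>2 + \<bar>real q - y\<bar> / y"
proof -
  define u where "u = (real q - y) / y"
  have u: "\<bar>u\<bar> \<le> 1/2" using y h by (simp add: u_def abs_divide field_simps)
  have q: "real q = y * (1 + u)" using y by (simp add: u_def field_simps)
  have q2: "real q \<ge> y / 2" using h by linarith
  then have q0: "q > 0" using y by (cases q) auto
  define e where "e = (1 + u) * ln (1 + u) - u - u\<^sup>2 / 2"
  have e: "\<bar>e\<bar> \<le> 2 * \<bar>u\<bar> ^ 3" unfolding e_def by (rule xlnx_quadratic_error[OF u])
  have u1: "1 + u > 0" using u by linarith
  have l: "ln (real q) = ln y + ln (1 + u)" unfolding q using y u1 by (subst ln_mult) auto
  have "\<bar>ln (1 + u) - u\<bar> \<le> 2 * u\<^sup>2"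
    using u by (intro abs_ln_one_plus_x_minus_x_bound) auto
  also have "2 * u\<^sup>2 = 2 * (\<bar>u\<bar> * \<bar>u\<bar>)" by (simp add: power2_eq_square)
  also have "\<dots> \<le> 2 * (\<bar>u\<bar> * (1/2))" using u by (intro mult_left_mono) auto
  finally have lu: "\<bar>ln (1 + u)\<bar> \<le> 2 * \<bar>u\<bar>" by linarith
  have "stirling_main (real q) = y * (1 + u) * (ln y + ln (1 + u)) - y * (1 + u) + (ln (2 * pi) + (ln y + ln (1 + u))) / 2"
    using q0 unfolding stirling_main_def l[symmetric] q[symmetric] by (simp add: ln_mult)
  moreover have "stirling_main y = y * ln y - y + (ln (2 * pi) + ln y) / 2"
    using y by (simp add: stirling_main_def ln_mult)
  moreover have "real q - y = y * u" by (simp add: q algebra_simps)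
  moreover have "(y * u)\<^sup>2 / (2 * y) = y * (u\<^sup>2 / 2)" using y by (simp add: power2_eq_square)
  ultimately have d: "stirling_main (real q) - (stirling_main y + (real q - y) * ln y + (real q - y)\<^sup>2 / (2 * y))
      = y * e + ln (1 + u) / 2"
    by (simp only: e_def) (simp add: field_simps)
  have "\<bar>y * e\<bar> \<le> y * (2 * \<bar>u\<bar> ^ 3)" using e y by (simp add: abs_mult)
  moreover have "y * (2 * \<bar>u\<bar> ^ 3) = 2 * \<bar>real q - y\<bar> ^ 3 / y\<^sup>2"
    using y by (simp add: u_def abs_divide power_divide power2_eq_square power3_eq_cube)
  moreover have "\<bar>u\<bar> = \<bar>real q - y\<bar> / y" using y by (simp add: u_def abs_divide)
  moreover have "\<bar>ln (fact q) - stirling_main (real q)\<bar> \<le> 16 / y"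
  proof -
    have "8 / real q \<le> 8 / (y / 2)" using q2 y q0 by (intro divide_left_mono) auto
    then show ?thesis using stirling_ln_fact[OF q0] by simp
  qed
  ultimately show ?thesis using d lu by linarith
qed

text \<open>
  On the scale of the fluctuations, \<open>\<bar>q - \<kappa> n\<bar>\<close> of order \<open>sqrt n\<close>, each of the three error terms is of
  order \<open>1 / sqrt n\<close>.
\<close>

lemma ln_fact_expansion:
  fixes \<kappa> R :: real
  assumes k: "\<kappa> > 0" and R: "R \<ge> 0"
  shows "\<exists>C\<ge>0. \<forall>\<^sub>F n in sequentially. \<forall>q::nat. \<bar>real q - \<kappa> * real n\<bar> \<le> R * sqrt (real n) \<longrightarrow>
     \<bar>ln (fact q) - (stirling_main (\<kappa> * real n) + (real q - \<kappa> * real n) * ln (\<kappa> * real n)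
        + (real q - \<kappa> * real n)\<^sup>2 / (2 * (\<kappa> * real n)))\<bar> \<le> C / sqrt (real n)"
proof (intro exI conjI)
  define C where "C = 16 / \<kappa> + 2 * R ^ 3 / \<kappa>\<^sup>2 + R / \<kappa>"
  show "C \<ge> 0" using k R by (simp add: C_def)
  have "\<forall>\<^sub>F n in sequentially. real n \<ge> max 1 ((2 * R / \<kappa>)\<^sup>2)"
    by (rule eventually_compose_filterlim[OF eventually_ge_at_top filterlim_real_sequentially])
  then show "\<forall>\<^sub>F n in sequentially. \<forall>q::nat. \<bar>real q - \<kappa> * real n\<bar> \<le> R * sqrt (real n) \<longrightarrow>
     \<bar>ln (fact q) - (stirling_main (\<kappa> * real n) + (real q - \<kappa> * real n) * ln (\<kappa> * real n)
        + (real q - \<kappa> * real n)\<^sup>2 / (2 * (\<kappa> * real n)))\<bar> \<le> C / sqrt (real n)"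
  proof eventually_elim
    case (elim n)
    define w where "w = sqrt (real n)"
    have w1: "w \<ge> 1" using elim by (simp add: w_def)
    have wn: "real n = w * w" by (simp add: w_def)
    have "2 * R / \<kappa> \<le> w" unfolding w_def using elim by (intro real_le_rsqrt) auto
    then have Rw: "R \<le> \<kappa> * w / 2" using k by (simp add: field_simps)
    show ?case
    proof (intro allI impI)
      fix q :: nat
      define h where "h = \<bar>real q - \<kappa> * real n\<bar>"
      assume "\<bar>real q - \<kappa> * real n\<bar> \<le> R * sqrt (real n)"
      then have h: "h \<le> R * w" by (simp add: w_def h_def)
      have h0: "h \<ge> 0" by (simp add: h_def)
      have y0: "\<kappa> * real n > 0" using k w1 by (simp add: wn)
      have "R * w \<le> (\<kappa> * w / 2) * w" using Rw w1 by (intro mult_right_mono) auto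
      then have h2: "h \<le> \<kappa> * real n / 2" using h by (simp add: wn)
      have "16 / (\<kappa> * real n) \<le> 16 / \<kappa> / w"
        using k w1 by (simp add: wn field_simps)
      moreover have "2 * h ^ 3 / (\<kappa> * real n)\<^sup>2 \<le> 2 * (R * w) ^ 3 / (\<kappa> * real n)\<^sup>2"
        using h h0 by (intro divide_right_mono mult_left_mono power_mono) auto
      moreover have "2 * (R * w) ^ 3 / (\<kappa> * real n)\<^sup>2 = 2 * R ^ 3 / \<kappa>\<^sup>2 / w"
        using k w1 by (simp add: wn field_simps power2_eq_square power3_eq_cube)
      moreover have "h / (\<kappa> * real n) \<le> R * w / (\<kappa> * real n)"
        using h y0 by (intro divide_right_mono) auto
      moreover have "R * w / (\<kappa> * real n) = R / \<kappa> / w"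
        using k w1 by (simp add: wn field_simps)
      moreover have "C / w = 16 / \<kappa> / w + 2 * R ^ 3 / \<kappa>\<^sup>2 / w + R / \<kappa> / w"
        by (simp add: C_def add_divide_distrib)
      ultimately show "\<bar>ln (fact q) - (stirling_main (\<kappa> * real n) + (real q - \<kappa> * real n) * ln (\<kappa> * real n)
        + (real q - \<kappa> * real n)\<^sup>2 / (2 * (\<kappa> * real n)))\<bar> \<le> C / sqrt (real n)"
        using ln_fact_expansion_bound[OF y0 h2[unfolded h_def]]
        unfolding w_def[symmetric] h_def[symmetric] by linarith
    qed
  qed
qed

section \<open>Local limits of the multinomial and the hypergeometric law\<close>

text \<open>
  The two laws of the vector of suit counts: draws with replacement (multinomial) and
  draws without replacement from \<open>card J\<close> classes of \<open>K\<close> cards each (hypergeometric). The number \<open>n\<close> of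
  draws is \<open>sum b J\<close>.
\<close>

definition multinomial_mass :: "'a set \<Rightarrow> ('a \<Rightarrow> nat) \<Rightarrow> real"
  where "multinomial_mass J b =
    fact (sum b J) / ((\<Prod>j\<in>J. fact (b j)) * real (card J) ^ sum b J)"

definition hypergeom_mass :: "nat \<Rightarrow> 'a set \<Rightarrow> ('a \<Rightarrow> nat) \<Rightarrow> real"
  where "hypergeom_mass K J b =
    (\<Prod>j\<in>J. real (K choose b j)) / real ((card J * K) choose sum b J)"

text \<open>
  This is \<open>\<parallel>X\<parallel>\<^sup>2\<close> for the rescaled count vector with coordinates \<open>X\<^sub>j = (m b\<^sub>j - n) / sqrt n\<close>, where
  \<open>m = card J\<close>; both local limits depend on the counts through it alone.
\<close>

definition dispersion :: "'a set \<Rightarrow> ('a \<Rightarrow> nat) \<Rightarrow> real"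
  where "dispersion J b =
    (\<Sum>j\<in>J. (real (card J) * real (b j) - real (sum b J))\<^sup>2) / real (sum b J)"

text \<open>
  Summing the expansion over \<open>J\<close> kills the linear terms, because the deviations add up to zero, and
  collects the quadratic ones into \<open>s / (2 \<kappa>)\<close>. The bound on \<open>s\<close> controls every single deviation. It
  serves both the drawn cards (\<open>\<kappa> = 1 / m\<close>) and the cards left in the deck (\<open>\<kappa> = (c - 1) / m\<close>).
\<close>

lemma sum_ln_fact_expansion:
  fixes \<kappa> S :: real and J :: "'a set"
  assumes k: "\<kappa> > 0" and S: "S \<ge> 0" and J: "finite J"
  shows "\<exists>C\<ge>0. \<forall>\<^sub>F n in sequentially. \<forall>(q::'a \<Rightarrow> nat) s.
     (\<Sum>j\<in>J. real (q j) - \<kappa> * real n) = 0 \<longrightarrow> (\<Sum>j\<in>J. (real (q j) - \<kappa> * real n)\<^sup>2) = s * real n \<longrightarrow> s \<le> S \<longrightarrow>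
     \<bar>(\<Sum>j\<in>J. ln (fact (q j))) - (real (card J) * stirling_main (\<kappa> * real n) + s / (2 * \<kappa>))\<bar> \<le> C / sqrt (real n)"
proof -
  obtain C where C: "C \<ge> 0" and ev: "\<forall>\<^sub>F n in sequentially. \<forall>q::nat. \<bar>real q - \<kappa> * real n\<bar> \<le> sqrt S * sqrt (real n) \<longrightarrow>
     \<bar>ln (fact q) - (stirling_main (\<kappa> * real n) + (real q - \<kappa> * real n) * ln (\<kappa> * real n)
        + (real q - \<kappa> * real n)\<^sup>2 / (2 * (\<kappa> * real n)))\<bar> \<le> C / sqrt (real n)"
    using ln_fact_expansion[OF k, of "sqrt S"] S by auto
  show ?thesis
  proof (intro exI conjI)
    show "real (card J) * C \<ge> 0" using C by simp
    show "\<forall>\<^sub>F n in sequentially. \<forall>(q::'a \<Rightarrow> nat) s.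
     (\<Sum>j\<in>J. real (q j) - \<kappa> * real n) = 0 \<longrightarrow> (\<Sum>j\<in>J. (real (q j) - \<kappa> * real n)\<^sup>2) = s * real n \<longrightarrow> s \<le> S \<longrightarrow>
     \<bar>(\<Sum>j\<in>J. ln (fact (q j))) - (real (card J) * stirling_main (\<kappa> * real n) + s / (2 * \<kappa>))\<bar>
        \<le> real (card J) * C / sqrt (real n)"
      using ev eventually_gt_at_top[of 0]
    proof eventually_elim
      case (elim n)
      show ?case
      proof (intro allI impI)
        fix q :: "'a \<Rightarrow> nat" and s :: real
        assume q1: "(\<Sum>j\<in>J. real (q j) - \<kappa> * real n) = 0"
          and q2: "(\<Sum>j\<in>J. (real (q j) - \<kappa> * real n)\<^sup>2) = s * real n" and sS: "s \<le> S"
        define y where "y = \<kappa> * real n"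
        have y: "y > 0" using k elim by (simp add: y_def)
        define t where "t = (\<lambda>j. stirling_main y + (real (q j) - y) * ln y + (real (q j) - y)\<^sup>2 / (2 * y))"
        have each: "\<bar>ln (fact (q j)) - t j\<bar> \<le> C / sqrt (real n)" if j: "j \<in> J" for j
        proof -
          have "(real (q j) - y)\<^sup>2 \<le> (\<Sum>j\<in>J. (real (q j) - \<kappa> * real n)\<^sup>2)"
            unfolding y_def by (rule member_le_sum[OF j]) (use J in auto)
          also have "\<dots> \<le> S * real n" unfolding q2 using sS by (intro mult_right_mono) auto
          finally have "\<bar>real (q j) - y\<bar> \<le> sqrt (S * real n)" by (metis real_sqrt_abs real_sqrt_le_iff)
          then show ?thesis using elim(1) by (simp add: t_def y_def real_sqrt_mult)
        qed
        have "(\<Sum>j\<in>J. t j) = real (card J) * stirling_main y + (\<Sum>j\<in>J. real (q j) - y) * ln y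
            + (\<Sum>j\<in>J. (real (q j) - y)\<^sup>2) / (2 * y)"
          by (simp add: t_def sum.distrib sum_distrib_right sum_divide_distrib)
        also have "(\<Sum>j\<in>J. real (q j) - y) = 0" using q1 by (simp add: y_def)
        also have "(\<Sum>j\<in>J. (real (q j) - y)\<^sup>2) = s * real n" using q2 by (simp add: y_def)
        also have "s * real n / (2 * y) = s / (2 * \<kappa>)" using elim by (simp add: y_def)
        finally have ts: "(\<Sum>j\<in>J. t j) = real (card J) * stirling_main y + s / (2 * \<kappa>)" by simp
        have "\<bar>(\<Sum>j\<in>J. ln (fact (q j))) - (\<Sum>j\<in>J. t j)\<bar> \<le> (\<Sum>j\<in>J. \<bar>ln (fact (q j)) - t j\<bar>)"
          by (simp add: sum_subtractf[symmetric])
        also have "\<dots> \<le> (\<Sum>j\<in>J. C / sqrt (real n))" by (intro sum_mono each)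
        finally show "\<bar>(\<Sum>j\<in>J. ln (fact (q j))) - (real (card J) * stirling_main (\<kappa> * real n) + s / (2 * \<kappa>))\<bar>
            \<le> real (card J) * C / sqrt (real n)" unfolding ts y_def by simp
      qed
    qed
  qed
qed

lemma sum_deviation:
  fixes b :: "'a \<Rightarrow> nat"
  assumes J: "finite J" "J \<noteq> {}" and n: "sum b J = n" "n > 0"
  defines "m \<equiv> real (card J)"
  shows "(\<Sum>j\<in>J. real (b j) - 1 / m * real n) = 0"
    and "(\<Sum>j\<in>J. (real (b j) - 1 / m * real n)\<^sup>2) = dispersion J b / m\<^sup>2 * real n"
proof -
  have m: "m > 0" using J by (simp add: m_def card_gt_0_iff)
  have "(\<Sum>j\<in>J. real (b j) - 1 / m * real n) = real (sum b J) - m * (1 / m * real n)"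
    by (simp add: sum_subtractf m_def)
  then show "(\<Sum>j\<in>J. real (b j) - 1 / m * real n) = 0" using n m by simp
  have "(real (b j) - 1 / m * real n)\<^sup>2 = (m * real (b j) - real n)\<^sup>2 / m\<^sup>2" for j
    using m by (simp add: power2_eq_square field_simps)
  then have "(\<Sum>j\<in>J. (real (b j) - 1 / m * real n)\<^sup>2) = (\<Sum>j\<in>J. (m * real (b j) - real n)\<^sup>2) / m\<^sup>2"
    by (simp add: sum_divide_distrib)
  then show "(\<Sum>j\<in>J. (real (b j) - 1 / m * real n)\<^sup>2) = dispersion J b / m\<^sup>2 * real n"
    using n by (simp add: dispersion_def m_def)
qed

text \<open>
  Logarithm of the normalising constant \<open>(2 \<pi> m)\<^bsup>-(m - 1)/2\<^esup> sqrt m\<close> of the Gaussian limit of variance \<open>m\<close> on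
  the hyperplane; the factor \<open>sqrt m\<close> is the ratio of surface measure to Lebesgue measure in the first
  \<open>m - 1\<close> coordinates.
\<close>

definition gauss_ln_const :: "real \<Rightarrow> real"
  where "gauss_ln_const m = (1 - m / 2) * ln m - (m - 1) / 2 * ln (2 * pi)"

text \<open>
  The summand \<open>(m - 1) ln (m / sqrt n)\<close> is the logarithm of the volume of a lattice cell: the points \<open>X\<close> have
  spacing \<open>m / sqrt n\<close> in each of \<open>m - 1\<close> free coordinates.
\<close>

lemma stirling_main_multinomial:
  assumes m: "m > 0" and n: "n > (0::real)"
  shows "stirling_main n - m * stirling_main (1 / m * n) - n * ln m
     = gauss_ln_const m + (m - 1) * ln (m / sqrt n)"
  using m n by (simp add: stirling_main_def gauss_ln_const_def ln_mult ln_div ln_sqrt field_simps)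

text \<open>
  All terms proportional to \<open>n\<close> cancel because the deck splits as \<open>c n = n + (c - 1) n\<close>; only the square
  roots in Stirling's formula survive.
\<close>

lemma stirling_main_ratio:
  assumes m: "m > 0" and n: "n > (0::real)" and c: "c > 1"
  shows "m * stirling_main (c / m * n) + stirling_main ((c - 1) * n) + n * ln m
      - m * stirling_main ((c - 1) / m * n) - stirling_main (c * n) = (m - 1) / 2 * ln (c / (c - 1))"
proof -
  define e where "e = c - 1"
  have e: "e > 0" "c = e + 1" using c by (auto simp: e_def)
  have c0: "c > 0" using c by simp
  have "m * stirling_main (c / m * n) + stirling_main (e * n) + n * ln m
      - m * stirling_main (e / m * n) - stirling_main (c * n)
      = (e + 1 - c) * n * ln m + (m - 1) / 2 * ln (c / e)"
    using m n e(1) c0 by (simp add: stirling_main_def ln_mult ln_div field_simps)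
  then show ?thesis by (simp add: e_def)
qed

lemma ln_multinomial_mass:
  assumes "finite J" "J \<noteq> {}" "sum b J = n"
  shows "ln (multinomial_mass J b) = ln (fact n) - (\<Sum>j\<in>J. ln (fact (b j))) - real n * ln (card J)"
proof -
  have "card J > 0" using assms by (simp add: card_gt_0_iff)
  moreover have "(\<Prod>j\<in>J. fact (b j)) > (0::real)" by (intro prod_pos) simp
  moreover have "ln (\<Prod>j\<in>J. fact (b j) :: real) = (\<Sum>j\<in>J. ln (fact (b j)))"
    by (rule ln_prod) (use assms in auto)
  ultimately show ?thesis
    using assms unfolding multinomial_mass_def by (simp add: ln_div ln_mult ln_realpow)
qed

lemma ln_hypergeom_mass:
  assumes J: "finite J" "J \<noteq> {}" and n: "sum b J = n" and bK: "\<And>j. j \<in> J \<Longrightarrow> b j \<le> K"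
  shows "ln (hypergeom_mass K J b) = ln (multinomial_mass J b)
     + (real (card J) * ln (fact K) + ln (fact (card J * K - n)) + real n * ln (card J)
        - (\<Sum>j\<in>J. ln (fact (K - b j))) - ln (fact (card J * K)))"
    and "hypergeom_mass K J b > 0"
proof -
  have nN: "n \<le> card J * K" using sum_bounded_above[of J b K] bK n by simp
  have 1: "real ((card J * K) choose n) = fact (card J * K) / (fact n * fact (card J * K - n))"
    using nN by (rule binomial_fact)
  have 2: "(\<Prod>j\<in>J. real (K choose b j)) = (\<Prod>j\<in>J. fact K / (fact (b j) * fact (K - b j)))"
    by (intro prod.cong refl binomial_fact bK)
  have 3: "ln (\<Prod>j\<in>J. fact K / (fact (b j) * fact (K - b j)) :: real)
      = (\<Sum>j\<in>J. ln (fact K / (fact (b j) * fact (K - b j))))"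
    by (rule ln_prod) (use J in auto)
  have 4: "(\<Sum>j\<in>J. ln (fact K / (fact (b j) * fact (K - b j)) :: real))
      = real (card J) * ln (fact K) - (\<Sum>j\<in>J. ln (fact (b j))) - (\<Sum>j\<in>J. ln (fact (K - b j)))"
    by (simp add: ln_div ln_mult sum_subtractf sum.distrib)
  have p: "(\<Prod>j\<in>J. fact K / (fact (b j) * fact (K - b j))) > (0::real)" by (intro prod_pos) simp
  then show "hypergeom_mass K J b > 0" unfolding hypergeom_mass_def n 1 2 by simp
  show "ln (hypergeom_mass K J b) = ln (multinomial_mass J b)
     + (real (card J) * ln (fact K) + ln (fact (card J * K - n)) + real n * ln (card J)
        - (\<Sum>j\<in>J. ln (fact (K - b j))) - ln (fact (card J * K)))"
    unfolding ln_multinomial_mass[OF J n] hypergeom_mass_def n 1 2 using p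
    by (simp add: ln_div ln_mult 3[unfolded 4])
qed

text \<open>
  Because \<open>c \<ge> m\<close>, no suit can run out before \<open>n\<close> cards are drawn.
\<close>

lemma counts_le_class_size:
  fixes b :: "'a \<Rightarrow> nat"
  assumes J: "finite J" "J \<noteq> {}" and n: "sum b J = n"
    and c: "c \<ge> real (card J)" and K: "real (card J) * real K = c * real n"
  shows "n \<le> K" and "\<And>j. j \<in> J \<Longrightarrow> b j \<le> K"
proof -
  have "real (card J) * real n \<le> real (card J) * real K"
    unfolding K using c by (intro mult_right_mono) auto
  then show nK: "n \<le> K" using J by (simp add: card_gt_0_iff)
  show "b j \<le> K" if "j \<in> J" for j
    using member_le_sum[OF that, of b] J n nK by simp
qed

lemma multinomial_mass_pos: "finite J \<Longrightarrow> J \<noteq> {} \<Longrightarrow> multinomial_mass J b > 0"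
  unfolding multinomial_mass_def by (intro divide_pos_pos mult_pos_pos prod_pos) (auto simp: card_gt_0_iff)

lemma stirling_ln_fact_proportional:
  assumes "real q = \<kappa> * real n" "\<kappa> \<ge> 1" "n > 0"
  shows "\<bar>ln (fact q) - stirling_main (\<kappa> * real n)\<bar> \<le> 8 / sqrt (real n)"
proof -
  have n1: "real n \<ge> 1" using assms by simp
  have "1 * real n \<le> \<kappa> * real n" using assms by (intro mult_right_mono) auto
  then have q: "real q \<ge> real n" using assms by simp
  then have "q > 0" using n1 by (cases q) auto
  have "sqrt (real n) \<le> real n" using n1 by (simp add: real_le_lsqrt power2_eq_square)
  then have "8 / real q \<le> 8 / sqrt (real n)" using q n1 by (intro divide_left_mono) auto
  then show ?thesis using stirling_ln_fact[OF \<open>q > 0\<close>] assms by simp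
qed

text \<open>
  The squares of the deviations \<open>b\<^sub>j - n / m\<close> add up to \<open>dispersion * n / m\<^sup>2\<close>, which the expansion with
  \<open>\<kappa> = 1 / m\<close> turns into the Gaussian exponent \<open>dispersion / (2 m)\<close>.
\<close>

lemma ln_multinomial_mass_limit:
  fixes J :: "'a set" and S :: real
  assumes J: "finite J" "J \<noteq> {}" and S: "S \<ge> 0"
  defines "m \<equiv> real (card J)"
  shows "\<exists>C\<ge>0. \<forall>\<^sub>F n in sequentially. \<forall>b. sum b J = n \<longrightarrow> dispersion J b \<le> S \<longrightarrow>
     \<bar>ln (multinomial_mass J b) - (gauss_ln_const m + (m - 1) * ln (m / sqrt (real n)) - dispersion J b / (2 * m))\<bar>
       \<le> C / sqrt (real n)"
proof -
  have m: "m > 0" using J by (simp add: m_def card_gt_0_iff)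
  obtain C where C: "C \<ge> 0" and ev: "\<forall>\<^sub>F n in sequentially. \<forall>(q::'a \<Rightarrow> nat) s.
     (\<Sum>j\<in>J. real (q j) - 1 / m * real n) = 0 \<longrightarrow> (\<Sum>j\<in>J. (real (q j) - 1 / m * real n)\<^sup>2) = s * real n \<longrightarrow> s \<le> S / m\<^sup>2 \<longrightarrow>
     \<bar>(\<Sum>j\<in>J. ln (fact (q j))) - (real (card J) * stirling_main (1 / m * real n) + s / (2 * (1 / m)))\<bar> \<le> C / sqrt (real n)"
    using sum_ln_fact_expansion[of "1 / m" "S / m\<^sup>2" J] m S J by auto
  show ?thesis
  proof (intro exI conjI)
    show "8 + C \<ge> 0" using C by simp
    show "\<forall>\<^sub>F n in sequentially. \<forall>b. sum b J = n \<longrightarrow> dispersion J b \<le> S \<longrightarrow>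
     \<bar>ln (multinomial_mass J b) - (gauss_ln_const m + (m - 1) * ln (m / sqrt (real n)) - dispersion J b / (2 * m))\<bar>
       \<le> (8 + C) / sqrt (real n)"
      using ev eventually_gt_at_top[of 0]
    proof eventually_elim
      case (elim n)
      show ?case
      proof (intro allI impI)
        fix b assume n: "sum b J = n" and s: "dispersion J b \<le> S"
        note dev = sum_deviation[OF J n elim(2), folded m_def]
        have "dispersion J b / m\<^sup>2 \<le> S / m\<^sup>2" using s m by (intro divide_right_mono) auto
        then have 1: "\<bar>(\<Sum>j\<in>J. ln (fact (b j))) - (m * stirling_main (1 / m * real n) + dispersion J b / m\<^sup>2 / (2 * (1 / m)))\<bar> \<le> C / sqrt (real n)"
          using elim(1) dev unfolding m_def by blast
        have 2: "dispersion J b / m\<^sup>2 / (2 * (1 / m)) = dispersion J b / (2 * m)"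
          using m by (simp add: power2_eq_square)
        have 3: "\<bar>ln (fact n) - stirling_main (real n)\<bar> \<le> 8 / sqrt (real n)"
          using stirling_ln_fact_proportional[of n 1 n] elim by simp
        have 4: "(8 + C) / sqrt (real n) = 8 / sqrt (real n) + C / sqrt (real n)"
          by (rule add_divide_distrib)
        show "\<bar>ln (multinomial_mass J b) - (gauss_ln_const m + (m - 1) * ln (m / sqrt (real n)) - dispersion J b / (2 * m))\<bar>
           \<le> (8 + C) / sqrt (real n)"
          using 1 3 stirling_main_multinomial[OF m, of "real n"] elim(2)
          unfolding ln_multinomial_mass[OF J n] 2 4 m_def[symmetric] by linarith
      qed
    qed
  qed
qed

text \<open>
  Relative to draws with replacement, only the cards left in the deck matter. Their counts deviate
  from \<open>(c - 1) n / m\<close> by the negatives of the deviations of the drawn counts, which gives the additional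
  exponent \<open>dispersion / (2 m (c - 1))\<close>.
\<close>

lemma ln_mass_ratio_limit:
  fixes J :: "'a set" and S :: real
  assumes J: "finite J" "J \<noteq> {}" and S: "S \<ge> 0" and c: "c \<ge> real (card J)" "c \<ge> 2"
  defines "m \<equiv> real (card J)"
  shows "\<exists>C\<ge>0. \<forall>\<^sub>F n in sequentially. \<forall>b K. sum b J = n \<longrightarrow> m * real K = c * real n \<longrightarrow> dispersion J b \<le> S \<longrightarrow>
     \<bar>ln (hypergeom_mass K J b) - (ln (multinomial_mass J b)
        + (m - 1) / 2 * ln (c / (c - 1)) - dispersion J b / (2 * m * (c - 1)))\<bar>
       \<le> C / sqrt (real n)"
proof -
  have m: "m > 0" using J by (simp add: m_def card_gt_0_iff)
  have c1: "c > 1" using c by simp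
  obtain C where C: "C \<ge> 0" and ev: "\<forall>\<^sub>F n in sequentially. \<forall>(q::'a \<Rightarrow> nat) s.
     (\<Sum>j\<in>J. real (q j) - (c - 1) / m * real n) = 0 \<longrightarrow> (\<Sum>j\<in>J. (real (q j) - (c - 1) / m * real n)\<^sup>2) = s * real n \<longrightarrow> s \<le> S / m\<^sup>2 \<longrightarrow>
     \<bar>(\<Sum>j\<in>J. ln (fact (q j))) - (real (card J) * stirling_main ((c - 1) / m * real n) + s / (2 * ((c - 1) / m)))\<bar> \<le> C / sqrt (real n)"
    using sum_ln_fact_expansion[of "(c - 1) / m" "S / m\<^sup>2" J] m S J c1 by auto
  show ?thesis
  proof (intro exI conjI)
    show "8 * m + 16 + C \<ge> 0" using C m by simp
    show "\<forall>\<^sub>F n in sequentially. \<forall>b K. sum b J = n \<longrightarrow> m * real K = c * real n \<longrightarrow> dispersion J b \<le> S \<longrightarrow>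
     \<bar>ln (hypergeom_mass K J b) - (ln (multinomial_mass J b)
        + (m - 1) / 2 * ln (c / (c - 1)) - dispersion J b / (2 * m * (c - 1)))\<bar>
       \<le> (8 * m + 16 + C) / sqrt (real n)"
      using ev eventually_gt_at_top[of 0]
    proof eventually_elim
      case (elim n)
      show ?case
      proof (intro allI impI)
        fix b K assume n: "sum b J = n" and K: "m * real K = c * real n" and s: "dispersion J b \<le> S"
        note dev = sum_deviation[OF J n elim(2), folded m_def]
        have K': "real K = c / m * real n" using K m by (simp add: field_simps)
        have cm: "c / m \<ge> 1" using c m by (simp add: m_def)
        note Kn = counts_le_class_size(1)[OF J n c(1) K[unfolded m_def]]
          and bK = counts_le_class_size(2)[OF J n c(1) K[unfolded m_def]]
        have N: "real (card J * K) = c * real n" using K by (simp add: m_def)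
        have "card J \<ge> 1" using J by (simp add: Suc_le_eq card_gt_0_iff)
        then have "1 * K \<le> card J * K" by (rule mult_right_mono) simp
        then have nN: "n \<le> card J * K" using Kn by linarith
        have Nn: "real (card J * K - n) = (c - 1) * real n"
          using nN N by (subst of_nat_diff) (auto simp: algebra_simps)
        have n0: "real n > 0" using elim(2) by simp
        have q: "real (K - b j) - (c - 1) / m * real n = - (real (b j) - 1 / m * real n)" if "j \<in> J" for j
          using bK[OF that] m by (simp add: of_nat_diff K' field_simps)
        have s1: "(\<Sum>j\<in>J. real (K - b j) - (c - 1) / m * real n) = 0"
        proof -
          have "(\<Sum>j\<in>J. real (K - b j) - (c - 1) / m * real n) = (\<Sum>j\<in>J. - (real (b j) - 1 / m * real n))"
            by (rule sum.cong[OF refl q])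
          then show ?thesis unfolding sum_negf dev(1) by simp
        qed
        have s2: "(\<Sum>j\<in>J. (real (K - b j) - (c - 1) / m * real n)\<^sup>2) = dispersion J b / m\<^sup>2 * real n"
        proof -
          have "(\<Sum>j\<in>J. (real (K - b j) - (c - 1) / m * real n)\<^sup>2) = (\<Sum>j\<in>J. (- (real (b j) - 1 / m * real n))\<^sup>2)"
            by (intro sum.cong refl arg_cong[where f = power2] q)
          then show ?thesis unfolding power2_minus dev(2) .
        qed
        have "dispersion J b / m\<^sup>2 \<le> S / m\<^sup>2" using s m by (intro divide_right_mono) auto
        then have 1: "\<bar>(\<Sum>j\<in>J. ln (fact (K - b j))) - (m * stirling_main ((c - 1) / m * real n) + dispersion J b / m\<^sup>2 / (2 * ((c - 1) / m)))\<bar> \<le> C / sqrt (real n)"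
          using elim(1)[rule_format, OF s1 s2] unfolding m_def by blast
        have 2: "dispersion J b / m\<^sup>2 / (2 * ((c - 1) / m)) = dispersion J b / (2 * m * (c - 1))"
          using m by (simp add: power2_eq_square)
        have 3: "\<bar>ln (fact (card J * K)) - stirling_main (c * real n)\<bar> \<le> 8 / sqrt (real n)"
          using elim c N by (intro stirling_ln_fact_proportional) auto
        have 4: "\<bar>ln (fact (card J * K - n)) - stirling_main ((c - 1) * real n)\<bar> \<le> 8 / sqrt (real n)"
          using elim c Nn by (intro stirling_ln_fact_proportional) auto
        have "\<bar>ln (fact K) - stirling_main (c / m * real n)\<bar> \<le> 8 / sqrt (real n)"
          using elim c K' cm by (intro stirling_ln_fact_proportional) auto
        then have "\<bar>m * (ln (fact K) - stirling_main (c / m * real n))\<bar> \<le> m * (8 / sqrt (real n))"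
          using m unfolding abs_mult by (intro mult_mono) auto
        then have 5: "\<bar>m * ln (fact K) - m * stirling_main (c / m * real n)\<bar> \<le> 8 * m / sqrt (real n)"
          by (simp add: algebra_simps)
        have 6: "(8 * m + 16 + C) / sqrt (real n) = 8 * m / sqrt (real n) + 8 / sqrt (real n) + 8 / sqrt (real n) + C / sqrt (real n)"
          by (simp add: add_divide_distrib)
        show "\<bar>ln (hypergeom_mass K J b) - (ln (multinomial_mass J b)
            + (m - 1) / 2 * ln (c / (c - 1)) - dispersion J b / (2 * m * (c - 1)))\<bar>
           \<le> (8 * m + 16 + C) / sqrt (real n)"
          using 1 3 4 5 stirling_main_ratio[OF m n0 c1] ln_hypergeom_mass(1)[OF J n bK, folded m_def]
          unfolding 2 6 by linarith
      qed
    qed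
  qed
qed

section \<open>Domination away from the mean and the uniform local limit\<close>

text \<open>
  Logarithm of the probability that \<open>a\<close> draws with replacement from \<open>K\<close> cards are pairwise distinct,
  the normalised falling factorial.
\<close>

definition ln_falling :: "nat \<Rightarrow> nat \<Rightarrow> real"
  where "ln_falling K a = (\<Sum>i<a. ln (1 - real i / real K))"

lemma ln_fact_falling:
  assumes "a \<le> K"
  shows "ln (fact K) - ln (fact (K - a)) = real a * ln (real K) + ln_falling K a"
  using assms
proof (induction a)
  case (Suc a)
  have aK: "a < K" using Suc.prems by simp
  have "K - a = Suc (K - Suc a)" using aK by simp
  then have "fact (K - a) = real (K - a) * fact (K - Suc a)" by (metis fact_Suc of_nat_mult of_nat_fact)
  then have 1: "ln (fact (K - a)) = ln (real (K - a)) + ln (fact (K - Suc a) :: real)"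
    using aK by (simp add: ln_mult)
  have "real (K - a) = real K * (1 - real a / real K)"
    using aK by (simp add: of_nat_diff field_simps)
  moreover have "1 - real a / real K > 0" using aK by (simp add: field_simps)
  ultimately have "ln (real (K - a)) = ln (real K) + ln (1 - real a / real K)"
    using aK by (simp add: ln_mult)
  then show ?case using Suc.IH aK 1 by (simp add: ln_falling_def algebra_simps)
qed (simp add: ln_falling_def)

text \<open>
  An exact formula for the logarithm of the likelihood ratio of the two laws. Stirling's formula controls
  it only where the dispersion is bounded; elsewhere concavity of \<open>ln_falling\<close> takes over.
\<close>

lemma ln_mass_ratio_eq_falling:
  assumes J: "finite J" "J \<noteq> {}" and n: "sum b J = n" and bK: "\<And>j. j \<in> J \<Longrightarrow> b j \<le> K" and K: "K > 0"
  shows "ln (hypergeom_mass K J b) - ln (multinomial_mass J b)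
     = (\<Sum>j\<in>J. ln_falling K (b j)) - ln_falling (card J * K) n"
proof -
  define m where "m = card J"
  have m: "m > 0" using J by (simp add: m_def card_gt_0_iff)
  have nN: "n \<le> m * K" using sum_bounded_above[of J b K] bK n by (simp add: m_def)
  have "(\<Sum>j\<in>J. ln (fact K) - ln (fact (K - b j))) = (\<Sum>j\<in>J. real (b j) * ln (real K) + ln_falling K (b j))"
    by (intro sum.cong refl ln_fact_falling bK)
  then have "real m * ln (fact K) - (\<Sum>j\<in>J. ln (fact (K - b j)))
     = real n * ln (real K) + (\<Sum>j\<in>J. ln_falling K (b j))"
    using n by (simp add: sum_subtractf sum.distrib m_def sum_distrib_right[symmetric] flip: of_nat_sum)
  moreover have "ln (fact (m * K)) - ln (fact (m * K - n)) = real n * ln (real (m * K)) + ln_falling (m * K) n"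
    by (rule ln_fact_falling[OF nN])
  moreover have "ln (real (m * K)) = ln (real m) + ln (real K)" using m K by (simp add: ln_mult)
  ultimately show ?thesis
    using ln_hypergeom_mass(1)[OF J n bK] unfolding m_def[symmetric] by (simp add: algebra_simps)
qed

text \<open>
  The increments \<open>ln (1 - i / K)\<close> of \<open>ln_falling\<close> decrease by at least \<open>1 / K\<close> per step, so it lies below a
  parabola of curvature \<open>-1 / K\<close> through the point \<open>b0\<close> with the slope at \<open>b0\<close>. The product
  \<open>(a - b0) (a - b0 - 1)\<close> is the discrete square.
\<close>

lemma ln_falling_concave:
  assumes b0: "b0 < K" and a: "a \<le> K"
  shows "ln_falling K a \<le> ln_falling K b0 + (real a - real b0) * ln (1 - real b0 / real K)
     - (real a - real b0) * (real a - real b0 - 1) / (2 * real K)"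
proof (cases "a \<ge> b0")
  case True
  have "ln_falling K (b0 + t) \<le> ln_falling K b0 + real t * ln (1 - real b0 / real K)
     - real t * (real t - 1) / (2 * real K)" if "b0 + t \<le> K" for t
    using that
  proof (induction t)
    case (Suc t)
    have lt: "b0 + t < K" using Suc.prems by simp
    define D where "D = real K - real b0"
    have D: "D > 0" "D \<le> real K" "real t < D" using lt by (auto simp: D_def)
    have "1 - real (b0 + t) / real K = (1 - real b0 / real K) * (1 - real t / D)"
      using D b0 by (simp add: D_def field_simps)
    moreover have p: "1 - real b0 / real K > 0" using b0 by (simp add: field_simps)
    moreover have "1 - real t / D > 0" using D by (simp add: field_simps)
    ultimately have "ln (1 - real (b0 + t) / real K) = ln (1 - real b0 / real K) + ln (1 - real t / D)"
      by (simp only: ln_mult_pos)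
    moreover have "ln (1 - real t / D) \<le> - (real t / D)"
      using D by (intro ln_one_minus_pos_upper_bound) (auto simp: field_simps)
    moreover have "real t / real K \<le> real t / D" using D by (intro divide_left_mono) auto
    ultimately have "ln (1 - real (b0 + t) / real K) \<le> ln (1 - real b0 / real K) - real t / real K" by linarith
    moreover have "ln_falling K (b0 + Suc t) = ln_falling K (b0 + t) + ln (1 - real (b0 + t) / real K)"
      by (simp add: ln_falling_def)
    moreover have "real (Suc t) * (real (Suc t) - 1) / (2 * real K)
        = real t * (real t - 1) / (2 * real K) + real t / real K"
      using b0 by (simp add: field_simps)
    moreover have "real (Suc t) * ln (1 - real b0 / real K)
        = real t * ln (1 - real b0 / real K) + ln (1 - real b0 / real K)" by (simp add: algebra_simps)
    moreover have "ln_falling K (b0 + t) \<le> ln_falling K b0 + real t * ln (1 - real b0 / real K)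
        - real t * (real t - 1) / (2 * real K)" using Suc lt by simp
    ultimately show ?case by linarith
  qed simp
  from this[of "a - b0"] True a show ?thesis by (simp add: of_nat_diff)
next
  case False
  have "ln_falling K (b0 - t) \<le> ln_falling K b0 - real t * ln (1 - real b0 / real K)
     - real t * (real t + 1) / (2 * real K)" if "t \<le> b0" for t
    using that
  proof (induction t)
    case (Suc t)
    have lt: "t < b0" using Suc.prems by simp
    define D where "D = real K - real b0"
    define D' where "D' = D + real t + 1"
    have D: "D > 0" "D' > 0" "D' \<le> real K" using b0 lt by (auto simp: D_def D'_def)
    have i: "real (b0 - Suc t) = real b0 - real t - 1" using lt by (simp add: of_nat_diff)
    have "1 - real b0 / real K = (1 - real (b0 - Suc t) / real K) * (D / D')"
      using D b0 unfolding i by (simp add: field_simps) (simp add: D_def D'_def algebra_simps)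
    moreover have p: "1 - real (b0 - Suc t) / real K > 0" using b0 by (simp add: field_simps)
    moreover have "D / D' > 0" using D by simp
    ultimately have "ln (1 - real b0 / real K) = ln (1 - real (b0 - Suc t) / real K) + ln (D / D')"
      by (simp only: ln_mult_pos)
    moreover have "ln (D / D') \<le> D / D' - 1" using D by (intro ln_le_minus_one) simp
    moreover have "D / D' - 1 = - ((real t + 1) / D')" using D by (simp add: D'_def field_simps)
    moreover have "(real t + 1) / real K \<le> (real t + 1) / D'" using D by (intro divide_left_mono) auto
    ultimately have "- ln (1 - real (b0 - Suc t) / real K) \<le> - ln (1 - real b0 / real K) - (real t + 1) / real K"
      by linarith
    moreover have "b0 - t = Suc (b0 - Suc t)" using lt by simp
    then have "ln_falling K (b0 - t) = ln_falling K (b0 - Suc t) + ln (1 - real (b0 - Suc t) / real K)"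
      by (simp add: ln_falling_def)
    moreover have "real (Suc t) * (real (Suc t) + 1) / (2 * real K)
        = real t * (real t + 1) / (2 * real K) + (real t + 1) / real K"
      using b0 by (simp add: field_simps)
    moreover have "real (Suc t) * ln (1 - real b0 / real K)
        = real t * ln (1 - real b0 / real K) + ln (1 - real b0 / real K)" by (simp add: algebra_simps)
    moreover have "ln_falling K (b0 - t) \<le> ln_falling K b0 - real t * ln (1 - real b0 / real K)
        - real t * (real t + 1) / (2 * real K)" using Suc lt by simp
    ultimately show ?case by linarith
  qed simp
  from this[of "b0 - a"] False show ?thesis
    by (simp add: of_nat_diff algebra_simps)
qed

text \<open>
  Compare \<open>n\<close> draws from the whole deck with \<open>m\<close> equal shares drawn from the single suits: group the draws
  from the deck into blocks of \<open>m\<close>, compare block \<open>k\<close> with step \<open>k + 1\<close> in each suit, and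
  telescope. The boundary step and the incomplete last block each cost at most \<open>m ln 2\<close>, since at most
  half of the deck is drawn.
\<close>

lemma ln_falling_split_deck:
  assumes m: "m > 0" and K: "K > 0" and nN: "2 * n \<le> m * K"
  shows "real m * ln_falling K (n div m) - ln_falling (m * K) n \<le> 2 * real m * ln 2"
proof -
  define b0 where "b0 = n div m"
  define N where "N = real (m * K)"
  have N: "N > 0" using m K by (simp add: N_def)
  have b0n: "b0 * m \<le> n" by (simp add: b0_def)
  have "2 * n \<le> K * m" using nN by (simp only: mult.commute)
  then have "2 * (b0 * m) \<le> K * m" using b0n by linarith
  then have "(2 * b0) * m \<le> K * m" by (simp only: mult.assoc)
  then have b0K: "2 * b0 \<le> K" using m by (simp only: mult_le_cancel2)
  have last: "- ln 2 \<le> ln (1 - x)" if "x \<le> 1/2" for x :: real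
  proof -
    have "ln (1/2) \<le> ln (1 - x)" using that by simp
    then show ?thesis by (simp add: ln_div)
  qed
  have "real m * ln_falling K b0 - real m * ln 2 \<le> real m * (ln_falling K b0 + ln (1 - real b0 / real K))"
  proof -
    have "- ln 2 \<le> ln (1 - real b0 / real K)" using b0K K by (intro last) (simp add: field_simps)
    then have "real m * (ln_falling K b0 - ln 2) \<le> real m * (ln_falling K b0 + ln (1 - real b0 / real K))"
      by (intro mult_left_mono) auto
    then show ?thesis by (simp add: right_diff_distrib)
  qed
  also have "ln_falling K b0 + ln (1 - real b0 / real K) = (\<Sum>k<b0. ln (1 - real (Suc k) / real K))"
    using sum.lessThan_Suc_shift[of "\<lambda>k. ln (1 - real k / real K)" b0] by (simp add: ln_falling_def)
  also have "real m * (\<Sum>k<b0. ln (1 - real (Suc k) / real K))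
      = (\<Sum>k<b0. \<Sum>i\<in>{k * m..<k * m + m}. ln (1 - real (Suc k) / real K))"
    by (simp add: sum_distrib_left)
  also have "\<dots> \<le> (\<Sum>k<b0. \<Sum>i\<in>{k * m..<k * m + m}. ln (1 - real i / N))"
  proof (intro sum_mono)
    fix k i assume k: "k \<in> {..<b0}" and i: "i \<in> {k * m..<k * m + m}"
    have "i \<le> Suc k * m" using i by simp
    then have "real i \<le> real (Suc k) * real m" by (metis of_nat_le_iff of_nat_mult)
    then have "real i / N \<le> real (Suc k) / real K"
      using N m K by (simp add: N_def field_simps del: of_nat_Suc)
    moreover have "real (Suc k) / real K < 1" using k b0K by (simp add: field_simps)
    ultimately show "ln (1 - real (Suc k) / real K) \<le> ln (1 - real i / N)" by simp
  qed
  also have "\<dots> = (\<Sum>i<b0 * m. ln (1 - real i / N))" by (rule sum.nat_group)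
  finally have 1: "real m * ln_falling K b0 - real m * ln 2 \<le> (\<Sum>i<b0 * m. ln (1 - real i / N))" .
  have "- (real m * ln 2) \<le> - (real (n - b0 * m) * ln 2)"
  proof -
    have "n - b0 * m \<le> m" using m by (simp add: b0_def minus_div_mult_eq_mod)
    then show ?thesis by (simp add: mult_right_mono)
  qed
  also have "\<dots> = (\<Sum>i\<in>{b0 * m..<n}. - ln (2::real))" by simp
  also have "\<dots> \<le> (\<Sum>i\<in>{b0 * m..<n}. ln (1 - real i / N))"
  proof (intro sum_mono last)
    fix i assume "i \<in> {b0 * m..<n}"
    then have "2 * i \<le> m * K" using nN by simp
    then have "2 * real i \<le> N" unfolding N_def by (metis of_nat_le_iff of_nat_mult of_nat_numeral)
    then show "real i / N \<le> 1 / 2" using N by (simp add: field_simps)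
  qed
  finally have 2: "- (real m * ln 2) \<le> (\<Sum>i\<in>{b0 * m..<n}. ln (1 - real i / N))" .
  have un: "{..<n} = {..<b0 * m} \<union> {b0 * m..<n}" using b0n by auto
  have "ln_falling (m * K) n = (\<Sum>i<b0 * m. ln (1 - real i / N)) + (\<Sum>i\<in>{b0 * m..<n}. ln (1 - real i / N))"
    unfolding ln_falling_def N_def[symmetric] un by (rule sum.union_disjoint) auto
  then show ?thesis using 1 2 unfolding b0_def[symmetric] by linarith
qed

text \<open>
  The concave parabolas of the single suits add up to a negative multiple of the dispersion, for every count
  vector. So once the dispersion exceeds a constant, the hypergeometric mass is below the multinomial one.
  Hence the positive part in the total variation distance only sees count vectors of bounded dispersion.
\<close>

lemma ln_mass_ratio_upper:
  assumes J: "finite J" "J \<noteq> {}" and n: "sum b J = n" "n > 0"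
    and c: "c \<ge> real (card J)" "c \<ge> 2" and K: "real (card J) * real K = c * real n"
  defines "m \<equiv> real (card J)"
  shows "ln (hypergeom_mass K J b) \<le> ln (multinomial_mass J b) + 2 * m * ln 2 + m / 2
     - dispersion J b / (2 * m * c)"
proof -
  have m: "m > 0" using J by (simp add: m_def card_gt_0_iff)
  then have m0: "card J > 0" by (simp add: m_def)
  have K': "real K = c / m * real n" using K m by (simp add: field_simps m_def)
  note Kn = counts_le_class_size(1)[OF J n(1) c(1) K]
    and bK = counts_le_class_size(2)[OF J n(1) c(1) K]
  have K0: "K > 0" using Kn n by simp
  have "2 * real n \<le> c * real n" using c by (intro mult_right_mono) auto
  then have "real (2 * n) \<le> real (card J * K)" using K by simp
  then have n2: "2 * n \<le> card J * K" by (simp only: of_nat_le_iff)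
  \<comment> \<open>The parabola is centred at the rounded mean, common to all suits, so that the linear terms add up to a multiple of \<open>\<rho>\<close>.\<close>
  define b0 where "b0 = n div card J"
  define \<rho> where "\<rho> = real n - m * real b0"
  have "n = card J * b0 + n mod card J" by (simp add: b0_def)
  then have "real n = m * real b0 + real (n mod card J)" unfolding m_def by (metis of_nat_add of_nat_mult)
  then have \<rho>: "0 \<le> \<rho>" "\<rho> \<le> m" using mod_less_divisor[OF m0, of n] by (auto simp: \<rho>_def m_def)
  have "2 * n \<le> K * card J" using n2 by (simp only: mult.commute)
  then have "2 * (b0 * card J) \<le> K * card J"
    using div_times_less_eq_dividend[of n "card J"] unfolding b0_def by linarith
  then have "(2 * b0) * card J \<le> K * card J" by (simp only: mult.assoc)
  then have "2 * b0 \<le> K" using m0 by (simp only: mult_le_cancel2)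
  then have b0K: "b0 < K" using K0 by simp
  note dev = sum_deviation[OF J n, folded m_def]
  have s1: "(\<Sum>j\<in>J. real (b j) - real b0) = \<rho>"
    using n by (simp add: sum_subtractf \<rho>_def m_def flip: of_nat_sum)
  define \<delta> where "\<delta> = 1 / m * real n - real b0"
  have "(\<Sum>j\<in>J. (real (b j) - real b0)\<^sup>2) = (\<Sum>j\<in>J. (real (b j) - 1 / m * real n)\<^sup>2 + 2 * \<delta> * (real (b j) - 1 / m * real n) + \<delta>\<^sup>2)"
  proof (intro sum.cong refl)
    have "(x - y)\<^sup>2 = (x - z)\<^sup>2 + 2 * (z - y) * (x - z) + (z - y)\<^sup>2" for x y z :: real
      by (simp add: power2_eq_square algebra_simps)
    then show "(real (b j) - real b0)\<^sup>2 = (real (b j) - 1 / m * real n)\<^sup>2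
        + 2 * \<delta> * (real (b j) - 1 / m * real n) + \<delta>\<^sup>2" for j
      unfolding \<delta>_def .
  qed
  also have "\<dots> = (\<Sum>j\<in>J. (real (b j) - 1 / m * real n)\<^sup>2) + 2 * \<delta> * (\<Sum>j\<in>J. real (b j) - 1 / m * real n) + m * \<delta>\<^sup>2"
    by (simp add: sum.distrib sum_distrib_left m_def)
  finally have s2: "(\<Sum>j\<in>J. (real (b j) - real b0)\<^sup>2) \<ge> dispersion J b / m\<^sup>2 * real n"
    unfolding dev using m by simp
  have "(\<Sum>j\<in>J. (real (b j) - real b0) * (real (b j) - real b0 - 1))
      = (\<Sum>j\<in>J. (real (b j) - real b0)\<^sup>2) - (\<Sum>j\<in>J. real (b j) - real b0)"
    by (subst sum_subtractf[symmetric], intro sum.cong refl) (simp add: power2_eq_square algebra_simps)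
  then have s3: "(\<Sum>j\<in>J. (real (b j) - real b0) * (real (b j) - real b0 - 1)) \<ge> dispersion J b / m\<^sup>2 * real n - m"
    using s1 s2 \<rho> by linarith
  have "(\<Sum>j\<in>J. ln_falling K (b j)) \<le> (\<Sum>j\<in>J. ln_falling K b0 + (real (b j) - real b0) * ln (1 - real b0 / real K)
     - (real (b j) - real b0) * (real (b j) - real b0 - 1) / (2 * real K))"
    by (intro sum_mono ln_falling_concave b0K bK)
  also have "\<dots> = m * ln_falling K b0 + \<rho> * ln (1 - real b0 / real K)
     - (\<Sum>j\<in>J. (real (b j) - real b0) * (real (b j) - real b0 - 1)) / (2 * real K)"
    by (simp add: sum_subtractf sum.distrib m_def flip: s1 sum_distrib_right sum_divide_distrib)
  also have "\<dots> \<le> m * ln_falling K b0 + 0 - (dispersion J b / m\<^sup>2 * real n - m) / (2 * real K)"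
  proof -
    have "\<rho> * ln (1 - real b0 / real K) \<le> 0"
      using \<rho> b0K by (intro mult_nonneg_nonpos) auto
    moreover have "(dispersion J b / m\<^sup>2 * real n - m) / (2 * real K)
        \<le> (\<Sum>j\<in>J. (real (b j) - real b0) * (real (b j) - real b0 - 1)) / (2 * real K)"
      using s3 K0 by (intro divide_right_mono) auto
    ultimately show ?thesis by linarith
  qed
  also have "(dispersion J b / m\<^sup>2 * real n - m) / (2 * real K) = dispersion J b / (2 * m * c) - m / (2 * real K)"
  proof -
    have "c > 0" using c by simp
    then have "dispersion J b / m\<^sup>2 * real n / (2 * real K) = dispersion J b / (2 * m * c)"
      unfolding K' using m n by (simp add: power2_eq_square)
    then show ?thesis by (simp only: diff_divide_distrib)
  qed
  also have "m / (2 * real K) \<le> m / 2"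
    using K0 m by (intro divide_left_mono) auto
  finally have "(\<Sum>j\<in>J. ln_falling K (b j)) \<le> m * ln_falling K b0 - dispersion J b / (2 * m * c) + m / 2"
    by linarith
  moreover have "m * ln_falling K b0 - ln_falling (card J * K) n \<le> 2 * m * ln 2"
    unfolding m_def b0_def by (rule ln_falling_split_deck[OF m0 K0 n2])
  ultimately show ?thesis using ln_mass_ratio_eq_falling[OF J n(1) bK K0] by linarith
qed

text \<open>
  The integrand \<open>\<G>\<close> as a function of \<open>s = \<parallel>X\<parallel>\<^sup>2\<close>.
\<close>

definition gauss_profile :: "real \<Rightarrow> real \<Rightarrow> real \<Rightarrow> real"
  where "gauss_profile m c s = exp (gauss_ln_const m) *
    (exp ((m - 1) / 2 * ln (c / (c - 1)) - c * s / (2 * m * (c - 1))) - exp (- s / (2 * m)))"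

text \<open>
  The threshold is the square of the radius: the ball is exactly the region where the density of the
  hypergeometric limit dominates that of the multinomial one.
\<close>

lemma gauss_profile_nonneg_iff:
  assumes "m > 0" "c > 1"
  shows "gauss_profile m c s \<ge> 0 \<longleftrightarrow> s \<le> m * (m - 1) * (c - 1) * ln (c / (c - 1))"
proof -
  define e where "e = c - 1"
  define L where "L = ln (c / e)"
  have e: "e > 0" "c = e + 1" using assms by (auto simp: e_def)
  have "gauss_profile m c s \<ge> 0 \<longleftrightarrow> - s / (2 * m) \<le> (m - 1) / 2 * L - c * s / (2 * m * e)"
    unfolding gauss_profile_def e_def[symmetric] L_def by (simp add: zero_le_mult_iff)
  also have "c * s / (2 * m * e) = s / (2 * m) + s / (2 * m * e)"
    using assms(1) e by (simp add: field_simps)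
  also have "- s / (2 * m) \<le> (m - 1) / 2 * L - (s / (2 * m) + s / (2 * m * e))
      \<longleftrightarrow> s / (2 * m * e) \<le> (m - 1) / 2 * L" by auto
  also have "\<dots> \<longleftrightarrow> s \<le> (m - 1) / 2 * L * (2 * m * e)"
    using assms(1) e(1) by (intro pos_divide_le_eq) auto
  also have "(m - 1) / 2 * L * (2 * m * e) = m * (m - 1) * e * L" by simp
  finally show ?thesis by (simp add: L_def e_def)
qed

lemma exp_perturb:
  fixes t e B :: real
  assumes e: "\<bar>e\<bar> \<le> 1" and t: "t \<le> B"
  shows "\<bar>exp (t + e) - exp t\<bar> \<le> exp B * (2 * \<bar>e\<bar>)"
proof -
  have "\<bar>exp e - 1\<bar> \<le> 2 * \<bar>e\<bar>"
  proof (cases "e \<ge> 0")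
    case True
    have "exp e \<le> 1 + e + e\<^sup>2" using True e by (intro exp_bound) auto
    moreover have "e\<^sup>2 \<le> e * 1" unfolding power2_eq_square using True e by (intro mult_left_mono) auto
    ultimately show ?thesis using True exp_ge_add_one_self[of e] by linarith
  next
    case False
    then have "exp e \<le> 1" by simp
    then show ?thesis using False exp_ge_add_one_self[of e] by linarith
  qed
  moreover have "exp (t + e) - exp t = exp t * (exp e - 1)" by (simp add: exp_add algebra_simps)
  moreover have "exp t \<le> exp B" using t by simp
  ultimately show ?thesis by (simp add: abs_mult mult_mono)
qed

text \<open>
  The logarithmic estimates pass to the masses because the exponents are bounded above, and to the positive
  part because it is a contraction.
\<close>

lemma local_limit:
  fixes J :: "'a set" and S :: real
  assumes J: "finite J" "J \<noteq> {}" and S: "S \<ge> 0" and c: "c \<ge> real (card J)" "c \<ge> 2"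
  defines "m \<equiv> real (card J)"
  shows "\<exists>C\<ge>0. \<forall>\<^sub>F n in sequentially. \<forall>b K. sum b J = n \<longrightarrow> m * real K = c * real n \<longrightarrow> dispersion J b \<le> S \<longrightarrow>
     \<bar>(sqrt (real n) / m) ^ (card J - 1) * max (hypergeom_mass K J b - multinomial_mass J b) 0
        - max (gauss_profile m c (dispersion J b)) 0\<bar> \<le> C / sqrt (real n)"
proof -
  have m: "m > 0" using J by (simp add: m_def card_gt_0_iff)
  have m1: "real (card J - 1) = m - 1" using J by (simp add: m_def of_nat_diff Suc_le_eq card_gt_0_iff)
  have c1: "c > 1" using c by simp
  obtain C1 where C1: "C1 \<ge> 0" and ev1: "\<forall>\<^sub>F n in sequentially. \<forall>b. sum b J = n \<longrightarrow> dispersion J b \<le> S \<longrightarrow>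
     \<bar>ln (multinomial_mass J b) - (gauss_ln_const m + (m - 1) * ln (m / sqrt (real n)) - dispersion J b / (2 * m))\<bar>
       \<le> C1 / sqrt (real n)"
    using ln_multinomial_mass_limit[OF J S] unfolding m_def by auto
  obtain C2 where C2: "C2 \<ge> 0" and ev2: "\<forall>\<^sub>F n in sequentially. \<forall>b K. sum b J = n \<longrightarrow> m * real K = c * real n \<longrightarrow> dispersion J b \<le> S \<longrightarrow>
     \<bar>ln (hypergeom_mass K J b) - (ln (multinomial_mass J b)
        + (m - 1) / 2 * ln (c / (c - 1)) - dispersion J b / (2 * m * (c - 1)))\<bar> \<le> C2 / sqrt (real n)"
    using ln_mass_ratio_limit[OF J S c] unfolding m_def by auto
  define A where "A = (m - 1) / 2 * ln (c / (c - 1))"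
  have A: "A \<ge> 0" using c1 m1 unfolding A_def
    by (intro mult_nonneg_nonneg ln_ge_zero) (auto simp: field_simps)
  define B where "B = gauss_ln_const m + A"
  define C where "C = exp B * (2 * C1) + exp B * (2 * (C1 + C2))"
  have lim: "\<forall>\<^sub>F n in sequentially. real n \<ge> (C1 + C2 + 1)\<^sup>2"
    by (rule eventually_compose_filterlim[OF eventually_ge_at_top filterlim_real_sequentially])
  show ?thesis
  proof (intro exI conjI)
    show "C \<ge> 0" using C1 C2 by (simp add: C_def)
    show "\<forall>\<^sub>F n in sequentially. \<forall>b K. sum b J = n \<longrightarrow> m * real K = c * real n \<longrightarrow> dispersion J b \<le> S \<longrightarrow>
     \<bar>(sqrt (real n) / m) ^ (card J - 1) * max (hypergeom_mass K J b - multinomial_mass J b) 0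
        - max (gauss_profile m c (dispersion J b)) 0\<bar> \<le> C / sqrt (real n)"
      using ev1 ev2 lim eventually_gt_at_top[of 0]
    proof eventually_elim
      case (elim n)
      show ?case
      proof (intro allI impI)
        fix b K assume n: "sum b J = n" and K: "m * real K = c * real n" and s: "dispersion J b \<le> S"
        define w where "w = sqrt (real n)"
        have w0: "w > 0" using elim by (simp add: w_def)
        have w: "C1 + C2 + 1 \<le> w" unfolding w_def using elim C1 C2 by (intro real_le_rsqrt) auto
        define s where "s = dispersion J b"
        have s0: "s \<ge> 0" unfolding s_def dispersion_def by (intro divide_nonneg_nonneg sum_nonneg) (auto intro: sum_nonneg)
        note bK = counts_le_class_size(2)[OF J n c(1) K[unfolded m_def]]
        define V where "V = (w / m) ^ (card J - 1)"
        have V: "V > 0" using w0 m by (simp add: V_def)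
        have lnV: "ln V = - ((m - 1) * ln (m / w))"
        proof -
          have "ln V = real (card J - 1) * ln (w / m)"
            using w0 m by (simp add: V_def ln_realpow)
          moreover have "ln (w / m) = - ln (m / w)" using w0 m by (simp add: ln_div)
          ultimately show ?thesis by (simp only: m1 mult_minus_right)
        qed
        define tM where "tM = gauss_ln_const m - s / (2 * m)"
        define tH where "tH = tM + (A - s / (2 * m * (c - 1)))"
        define eM where "eM = ln (V * multinomial_mass J b) - tM"
        define eH where "eH = ln (V * hypergeom_mass K J b) - tH"
        have Mpos: "multinomial_mass J b > 0" by (rule multinomial_mass_pos[OF J])
        have Hpos: "hypergeom_mass K J b > 0" by (rule ln_hypergeom_mass(2)[OF J n bK])
        have 1: "\<bar>eM\<bar> \<le> C1 / w"
        proof -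
          have "ln (V * multinomial_mass J b) = ln V + ln (multinomial_mass J b)"
            using V Mpos by (simp add: ln_mult)
          then show ?thesis using elim(1)[rule_format, OF n \<open>dispersion J b \<le> S\<close>]
            unfolding eM_def tM_def lnV s_def w_def by linarith
        qed
        have 2: "\<bar>eH\<bar> \<le> (C1 + C2) / w"
        proof -
          have "ln (V * hypergeom_mass K J b) = ln V + ln (hypergeom_mass K J b)"
            using V Hpos by (simp add: ln_mult)
          moreover have "ln (V * multinomial_mass J b) = ln V + ln (multinomial_mass J b)"
            using V Mpos by (simp add: ln_mult)
          moreover have "(C1 + C2) / w = C1 / w + C2 / w" by (rule add_divide_distrib)
          ultimately show ?thesis using 1 elim(2)[rule_format, OF n K \<open>dispersion J b \<le> S\<close>]
            unfolding eM_def eH_def tH_def A_def s_def w_def[symmetric] by linarith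
        qed
        have sm: "s / (2 * m * (c - 1)) \<ge> 0" "s / (2 * m) \<ge> 0" using s0 m c1 by auto
        then have tM: "tM \<le> B" using A unfolding tM_def B_def by linarith
        have tH: "tH \<le> B" using sm unfolding tM_def tH_def B_def by linarith
        have "C1 / w \<le> 1" "(C1 + C2) / w \<le> 1" using w w0 C1 C2 by auto
        then have e1: "\<bar>eM\<bar> \<le> 1" "\<bar>eH\<bar> \<le> 1" using 1 2 by linarith+
        have "\<bar>exp (tM + eM) - exp tM\<bar> \<le> exp B * (2 * \<bar>eM\<bar>)" by (rule exp_perturb[OF e1(1) tM])
        also have "\<dots> \<le> exp B * (2 * (C1 / w))" using 1 by (intro mult_left_mono) auto
        also have "exp (tM + eM) = V * multinomial_mass J b" using V Mpos by (simp add: eM_def)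
        finally have 3: "\<bar>V * multinomial_mass J b - exp tM\<bar> \<le> exp B * (2 * (C1 / w))" .
        have "\<bar>exp (tH + eH) - exp tH\<bar> \<le> exp B * (2 * \<bar>eH\<bar>)" by (rule exp_perturb[OF e1(2) tH])
        also have "\<dots> \<le> exp B * (2 * ((C1 + C2) / w))" using 2 by (intro mult_left_mono) auto
        also have "exp (tH + eH) = V * hypergeom_mass K J b" using V Hpos by (simp add: eH_def)
        finally have 4: "\<bar>V * hypergeom_mass K J b - exp tH\<bar> \<le> exp B * (2 * ((C1 + C2) / w))" .
        have "tH = gauss_ln_const m + (A - c * s / (2 * m * (c - 1)))"
        proof -
          have "c * s / (2 * m * (c - 1)) = s / (2 * m) + s / (2 * m * (c - 1))"
            using m c1 by (simp add: field_simps)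
          then show ?thesis by (simp add: tH_def tM_def)
        qed
        moreover have "tM = gauss_ln_const m + (- s / (2 * m))" by (simp add: tM_def)
        ultimately have g: "gauss_profile m c s = exp tH - exp tM"
          by (simp only: gauss_profile_def A_def[symmetric] exp_add right_diff_distrib)
        have "V * max (hypergeom_mass K J b - multinomial_mass J b) 0
            = max (V * hypergeom_mass K J b - V * multinomial_mass J b) 0"
          using V by (simp add: max_def algebra_simps)
        moreover have "C / w = exp B * (2 * (C1 / w)) + exp B * (2 * ((C1 + C2) / w))"
          unfolding C_def by (subst add_divide_distrib) (simp only: times_divide_eq_right)
        ultimately show "\<bar>(sqrt (real n) / m) ^ (card J - 1) * max (hypergeom_mass K J b - multinomial_mass J b) 0
          - max (gauss_profile m c (dispersion J b)) 0\<bar> \<le> C / sqrt (real n)"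
          using 3 4 unfolding V_def[symmetric] w_def[symmetric] s_def[symmetric] g by linarith
      qed
    qed
  qed
qed

text \<open>
  Beyond a threshold \<open>S\<close> both positive parts vanish, so the approximation of bounded dispersion is
  uniform over all count vectors.
\<close>

theorem uniform_local_limit:
  fixes J :: "'a set"
  assumes J: "finite J" "J \<noteq> {}" and c: "c \<ge> real (card J)" "c \<ge> 2"
  defines "m \<equiv> real (card J)"
  shows "\<exists>C\<ge>0. \<exists>S\<ge>0. (\<forall>s>S. gauss_profile m c s \<le> 0) \<and> (\<forall>\<^sub>F n in sequentially. \<forall>b K. sum b J = n \<longrightarrow> m * real K = c * real n \<longrightarrow>
     (dispersion J b > S \<longrightarrow> hypergeom_mass K J b \<le> multinomial_mass J b) \<and>
     \<bar>(sqrt (real n) / m) ^ (card J - 1) * max (hypergeom_mass K J b - multinomial_mass J b) 0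
        - max (gauss_profile m c (dispersion J b)) 0\<bar> \<le> C / sqrt (real n))"
proof -
  have m: "m > 0" using J by (simp add: m_def card_gt_0_iff)
  have c1: "c > 1" using c by simp
  define S1 where "S1 = 2 * m * c * (2 * m * ln 2 + m / 2)"
  define S2 where "S2 = m * (m - 1) * (c - 1) * ln (c / (c - 1))"
  define S where "S = max S1 S2"
  have "S1 \<ge> 0" using m c1 unfolding S1_def by (intro mult_nonneg_nonneg add_nonneg_nonneg) auto
  then have S: "S \<ge> 0" by (simp add: S_def)
  obtain C where C: "C \<ge> 0" and ev: "\<forall>\<^sub>F n in sequentially. \<forall>b K. sum b J = n \<longrightarrow> m * real K = c * real n \<longrightarrow> dispersion J b \<le> S \<longrightarrow>
     \<bar>(sqrt (real n) / m) ^ (card J - 1) * max (hypergeom_mass K J b - multinomial_mass J b) 0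
        - max (gauss_profile m c (dispersion J b)) 0\<bar> \<le> C / sqrt (real n)"
    using local_limit[OF J S c] unfolding m_def by auto
  have g: "gauss_profile m c s \<le> 0" if "s > S" for s
    using gauss_profile_nonneg_iff[OF m c1, of s] that by (auto simp: S_def S2_def)
  have "\<forall>\<^sub>F n in sequentially. \<forall>b K. sum b J = n \<longrightarrow> m * real K = c * real n \<longrightarrow>
     (dispersion J b > S \<longrightarrow> hypergeom_mass K J b \<le> multinomial_mass J b) \<and>
     \<bar>(sqrt (real n) / m) ^ (card J - 1) * max (hypergeom_mass K J b - multinomial_mass J b) 0
        - max (gauss_profile m c (dispersion J b)) 0\<bar> \<le> C / sqrt (real n)"
    using ev eventually_gt_at_top[of 0]
  proof eventually_elim
    case (elim n)
    show ?case
    proof (intro allI impI)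
      fix b K assume n: "sum b J = n" and K: "m * real K = c * real n"
      have out: "hypergeom_mass K J b \<le> multinomial_mass J b" if "dispersion J b > S"
      proof -
        have "dispersion J b \<ge> S1" using that by (simp add: S_def)
        then have "dispersion J b / (2 * m * c) \<ge> S1 / (2 * m * c)"
          using m c1 by (intro divide_right_mono) auto
        also have "S1 / (2 * m * c) = 2 * m * ln 2 + m / 2" using m c1 by (simp add: S1_def)
        finally have "ln (hypergeom_mass K J b) \<le> ln (multinomial_mass J b)"
          using ln_mass_ratio_upper[OF J n elim(2) c K[unfolded m_def]] unfolding m_def[symmetric] by linarith
        moreover have "hypergeom_mass K J b > 0"
          by (rule ln_hypergeom_mass(2)[OF J n counts_le_class_size(2)[OF J n c(1) K[unfolded m_def]]])
        ultimately show ?thesis using multinomial_mass_pos[OF J, of b] by simp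
      qed
      show "(dispersion J b > S \<longrightarrow> hypergeom_mass K J b \<le> multinomial_mass J b) \<and>
     \<bar>(sqrt (real n) / m) ^ (card J - 1) * max (hypergeom_mass K J b - multinomial_mass J b) 0
        - max (gauss_profile m c (dispersion J b)) 0\<bar> \<le> C / sqrt (real n)"
      proof (cases "dispersion J b \<le> S")
        case True
        then show ?thesis using elim(1) n K by auto
      next
        case False
        then show ?thesis using out g[of "dispersion J b"] C by (simp add: max_def)
      qed
    qed
  qed
  then show ?thesis using C S g by blast
qed

section \<open>Counting words and shuffles\<close>

definition letter_count :: "(nat \<Rightarrow> 'a) \<Rightarrow> nat \<Rightarrow> 'a \<Rightarrow> nat"
  where "letter_count \<omega> n j = card {t\<in>{1..n}. \<omega> t = j}"

lemma letter_count_0 [simp]: "letter_count \<omega> 0 j = 0"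
  by (simp add: letter_count_def)

lemma letter_count_Suc:
  "letter_count \<omega> (Suc n) j = letter_count \<omega> n j + (if \<omega> (Suc n) = j then 1 else 0)"
proof -
  have "{t\<in>{1..Suc n}. \<omega> t = j} = {t\<in>{1..n}. \<omega> t = j} \<union> (if \<omega> (Suc n) = j then {Suc n} else {})"
    by (auto simp: le_Suc_eq)
  then show ?thesis unfolding letter_count_def by (auto simp: card_insert_if)
qed

lemma sum_letter_count:
  assumes "\<omega> \<in> {1..n} \<rightarrow> J" "finite J"
  shows "(\<Sum>j\<in>J. letter_count \<omega> n j) = n"
proof -
  have "card {1..n} = (\<Sum>j\<in>J. card {t\<in>{1..n}. \<omega> t = j})"
    using assms by (subst card_eq_sum, subst sum.group[symmetric, of "{1..n}" J \<omega>]) auto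
  then show ?thesis by (simp add: letter_count_def)
qed

text \<open>
  Words with prescribed letter counts, read as lists, are the arrangements of a multiset.
\<close>

lemma card_words_letter_count:
  assumes J: "finite J" and b: "sum b J = n"
  shows "real (card {\<omega> \<in> {1..n} \<rightarrow>\<^sub>E J. \<forall>j\<in>J. letter_count \<omega> n j = b j}) = fact n / (\<Prod>j\<in>J. fact (b j))"
proof -
  define W where "W = {\<omega> \<in> {1..n} \<rightarrow>\<^sub>E J. \<forall>j\<in>J. letter_count \<omega> n j = b j}"
  define A where "A = (\<Sum>j\<in>J. replicate_mset (b j) j)"
  define \<Phi> where "\<Phi> = (\<lambda>\<omega> :: nat \<Rightarrow> 'a. map \<omega> [1..<Suc n])"
  have cA: "count A x = (if x \<in> J then b x else 0)" for x
  proof -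
    have "count A x = (\<Sum>j\<in>J. if j = x then b j else 0)"
      unfolding A_def by (simp add: count_sum) (auto intro: sum.cong)
    then show ?thesis using J by simp
  qed
  have sA: "size A = n" unfolding A_def using b by (simp add: size_multiset_sum)
  have c\<Phi>: "count (mset (\<Phi> \<omega>)) x = letter_count \<omega> n x" for \<omega> x
  proof -
    have "count (mset (\<Phi> \<omega>)) x = length (filter (\<lambda>t. x = \<omega> t) [1..<Suc n])"
      unfolding \<Phi>_def count_mset count_list_eq_length_filter filter_map by (simp add: o_def del: upt_Suc)
    also have "\<dots> = card (set (filter (\<lambda>t. x = \<omega> t) [1..<Suc n]))"
      by (rule distinct_card[symmetric]) simp
    also have "set (filter (\<lambda>t. x = \<omega> t) [1..<Suc n]) = {t\<in>{1..n}. \<omega> t = x}" by auto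
    finally show ?thesis by (simp add: letter_count_def)
  qed
  have "bij_betw \<Phi> W (permutations_of_multiset A)"
  proof (rule bij_betwI[where g = "\<lambda>xs. \<lambda>t\<in>{1..n}. xs ! (t - 1)"])
    show "\<Phi> \<in> W \<rightarrow> permutations_of_multiset A"
    proof
      fix \<omega> assume w: "\<omega> \<in> W"
      have "letter_count \<omega> n x = 0" if "x \<notin> J" for x
        using w that by (auto simp: W_def letter_count_def)
      then have "mset (\<Phi> \<omega>) = A"
        using w by (intro multiset_eqI) (auto simp: c\<Phi> cA W_def)
      then show "\<Phi> \<omega> \<in> permutations_of_multiset A" by (simp add: permutations_of_multiset_def)
    qed
    have inv2: "\<Phi> (\<lambda>t\<in>{1..n}. xs ! (t - 1)) = xs" if "length xs = n" for xs :: "'a list"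
      unfolding \<Phi>_def using that by (intro nth_equalityI) (auto simp del: upt_Suc)
    show "(\<lambda>xs. \<lambda>t\<in>{1..n}. xs ! (t - 1)) \<in> permutations_of_multiset A \<rightarrow> W"
    proof
      fix xs assume xs: "xs \<in> permutations_of_multiset A"
      then have m: "mset xs = A" by (simp add: permutations_of_multiset_def)
      then have len: "length xs = n" using sA by (metis size_mset)
      have "xs ! i \<in> J" if "i < n" for i
      proof -
        have "count A (xs ! i) > 0" using that len m by (metis nth_mem count_greater_zero_iff set_mset_mset)
        then show ?thesis by (simp add: cA split: if_splits)
      qed
      moreover have "letter_count (\<lambda>t\<in>{1..n}. xs ! (t - 1)) n j = b j" if "j \<in> J" for j
        using c\<Phi>[of "\<lambda>t\<in>{1..n}. xs ! (t - 1)" j] that unfolding inv2[OF len] m by (simp add: cA)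
      ultimately show "(\<lambda>t\<in>{1..n}. xs ! (t - 1)) \<in> W" by (auto simp: W_def)
    qed
    show "(\<lambda>t\<in>{1..n}. \<Phi> \<omega> ! (t - 1)) = \<omega>" if "\<omega> \<in> W" for \<omega>
    proof
      fix t show "(\<lambda>t\<in>{1..n}. \<Phi> \<omega> ! (t - 1)) t = \<omega> t"
      proof (cases "t \<in> {1..n}")
        case True
        then have "\<Phi> \<omega> ! (t - 1) = \<omega> ([1..<Suc n] ! (t - 1))"
          unfolding \<Phi>_def by (intro nth_map) (auto simp del: upt_Suc)
        also have "[1..<Suc n] ! (t - 1) = t" using True by (subst nth_upt) auto
        finally show ?thesis using True by simp
      next
        case False
        then show ?thesis using that by (auto simp: W_def PiE_def extensional_def)
      qed
    qed
    show "\<Phi> (\<lambda>t\<in>{1..n}. xs ! (t - 1)) = xs" if "xs \<in> permutations_of_multiset A" for xs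
      using that sA by (intro inv2) (auto simp: permutations_of_multiset_def)
  qed
  then have cW: "card W = card (permutations_of_multiset A)" by (rule bij_betw_same_card)
  have "(\<Prod>x\<in>set_mset A. fact (count A x) :: nat) = (\<Prod>j\<in>J. fact (count A j))"
  proof (rule prod.mono_neutral_left[OF J])
    show "set_mset A \<subseteq> J" using cA by (metis count_greater_zero_iff less_irrefl subsetI)
    show "\<forall>i\<in>J - set_mset A. fact (count A i) = (1::nat)" by (auto simp: not_in_iff)
  qed
  also have "\<dots> = (\<Prod>j\<in>J. fact (b j))" by (simp add: cA)
  finally have "card W * (\<Prod>j\<in>J. fact (b j)) = fact n"
    using card_permutations_of_multiset_aux[of A] by (simp add: cW sA)
  then have "real (card W * (\<Prod>j\<in>J. fact (b j))) = real (fact n)" by (rule arg_cong)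
  then have "real (card W) * (\<Prod>j\<in>J. fact (b j)) = fact n" by simp
  moreover have "(\<Prod>j\<in>J. fact (b j) :: real) \<noteq> 0" using J by simp
  ultimately show ?thesis unfolding W_def[symmetric] by (simp add: field_simps)
qed

definition matching_perms :: "(nat \<Rightarrow> 'a) \<Rightarrow> nat \<Rightarrow> (nat \<Rightarrow> 'a) \<Rightarrow> nat \<Rightarrow> (nat \<Rightarrow> nat) set"
  where "matching_perms col N \<omega> n = {\<sigma>. \<sigma> permutes {1..N} \<and> (\<forall>t\<in>{1..n}. col (\<sigma> t) = \<omega> t)}"

lemma finite_matching_perms: "finite (matching_perms col N \<omega> n)"
  unfolding matching_perms_def by (rule finite_subset[OF _ finite_permutations[of "{1..N}"]]) auto

text \<open>
  Count twice the pairs of a shuffle matching the first \<open>n\<close> colours and a later position \<open>s\<close> that holds a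
  card of the next prescribed colour. For a given shuffle the number of such positions is the number of
  unused cards of that colour; for a given position, swapping \<open>s\<close> with \<open>n + 1\<close> gives the shuffles that
  match one colour more.
\<close>

lemma matching_perms_step:
  assumes n: "n < N" and K: "card {s\<in>{1..N}. col s = \<omega> (Suc n)} = K"
  shows "card (matching_perms col N \<omega> (Suc n)) * (N - n)
    = card (matching_perms col N \<omega> n) * (K - letter_count \<omega> n (\<omega> (Suc n)))"
proof -
  define P where "P = matching_perms col N \<omega> n"
  define Q where "Q = matching_perms col N \<omega> (Suc n)"
  define T where "T = {Suc n..N}"
  let ?j = "\<omega> (Suc n)"
  have fin: "finite P" "finite T" by (auto simp: P_def T_def finite_matching_perms)
  have slots: "card {s\<in>T. col (\<sigma> s) = ?j} = K - letter_count \<omega> n ?j" if s: "\<sigma> \<in> P" for \<sigma>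
  proof -
    have p: "\<sigma> permutes {1..N}" and c: "\<And>t. t \<in> {1..n} \<Longrightarrow> col (\<sigma> t) = \<omega> t"
      using s by (auto simp: P_def matching_perms_def)
    have "bij_betw \<sigma> {s\<in>{1..N}. col (\<sigma> s) = ?j} {s\<in>{1..N}. col s = ?j}"
    proof (rule bij_betw_imageI)
      show "inj_on \<sigma> {s\<in>{1..N}. col (\<sigma> s) = ?j}" using permutes_inj[OF p] by (rule inj_on_subset) simp
      have "s \<in> \<sigma> ` {s\<in>{1..N}. col (\<sigma> s) = ?j}" if "s \<in> {1..N}" "col s = ?j" for s
      proof -
        have "s \<in> \<sigma> ` {1..N}" using that permutes_image[OF p] by simp
        then show ?thesis using that by auto
      qed
      then show "\<sigma> ` {s\<in>{1..N}. col (\<sigma> s) = ?j} = {s\<in>{1..N}. col s = ?j}"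
        using permutes_in_image[OF p] by auto
    qed
    then have "card {s\<in>{1..N}. col (\<sigma> s) = ?j} = K" using K by (simp add: bij_betw_same_card)
    moreover have "{s\<in>{1..N}. col (\<sigma> s) = ?j} = {t\<in>{1..n}. \<omega> t = ?j} \<union> {s\<in>T. col (\<sigma> s) = ?j}"
      using n c by (auto simp: T_def)
    moreover have "card ({t\<in>{1..n}. \<omega> t = ?j} \<union> {s\<in>T. col (\<sigma> s) = ?j})
        = card {t\<in>{1..n}. \<omega> t = ?j} + card {s\<in>T. col (\<sigma> s) = ?j}"
      by (rule card_Un_disjoint) (auto simp: T_def)
    ultimately show ?thesis by (simp add: letter_count_def)
  qed
  have swap: "card {\<sigma>\<in>P. col (\<sigma> s) = ?j} = card Q" if s: "s \<in> T" for s
  proof -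
    define \<tau> where "\<tau> = Transposition.transpose s (Suc n)"
    have \<tau>p: "\<tau> permutes {1..N}" using s n unfolding \<tau>_def by (intro permutes_swap_id) (auto simp: T_def)
    have \<tau>t: "\<tau> t = t" if "t \<in> {1..n}" for t using that s by (auto simp: \<tau>_def T_def Transposition.transpose_def)
    have \<tau>s: "\<tau> s = Suc n" "\<tau> (Suc n) = s" by (auto simp: \<tau>_def)
    have \<tau>\<tau>: "\<tau> \<circ> \<tau> = id" by (auto simp: \<tau>_def fun_eq_iff)
    have comp: "x \<circ> \<tau> permutes {Suc 0..N}" if "x permutes {Suc 0..N}" for x
      using permutes_compose[OF \<tau>p] that by simp
    have "bij_betw (\<lambda>\<sigma>. \<sigma> \<circ> \<tau>) {\<sigma>\<in>P. col (\<sigma> s) = ?j} Q"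
    proof (rule bij_betwI[where g = "\<lambda>\<sigma>. \<sigma> \<circ> \<tau>"])
      show "(\<lambda>\<sigma>. \<sigma> \<circ> \<tau>) \<in> {\<sigma>\<in>P. col (\<sigma> s) = ?j} \<rightarrow> Q"
        using \<tau>t \<tau>s by (auto simp: P_def Q_def matching_perms_def le_Suc_eq intro: comp)
      show "(\<lambda>\<sigma>. \<sigma> \<circ> \<tau>) \<in> Q \<rightarrow> {\<sigma>\<in>P. col (\<sigma> s) = ?j}"
        using \<tau>t \<tau>s by (auto simp: P_def Q_def matching_perms_def intro: comp)
    qed (simp_all add: comp_assoc \<tau>\<tau>)
    then show ?thesis by (rule bij_betw_same_card)
  qed
  have "card P * (K - letter_count \<omega> n ?j) = (\<Sum>\<sigma>\<in>P. card {s\<in>T. col (\<sigma> s) = ?j})"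
    using slots by simp
  also have "\<dots> = (\<Sum>\<sigma>\<in>P. \<Sum>s\<in>T. if col (\<sigma> s) = ?j then 1 else 0)"
    using fin by (simp add: sum.If_cases Int_def)
  also have "\<dots> = (\<Sum>s\<in>T. \<Sum>\<sigma>\<in>P. if col (\<sigma> s) = ?j then 1 else 0)" by (rule sum.swap)
  also have "\<dots> = (\<Sum>s\<in>T. card {\<sigma>\<in>P. col (\<sigma> s) = ?j})"
    using fin by (simp add: sum.If_cases Int_def)
  also have "\<dots> = (N - n) * card Q" using swap by (simp add: T_def)
  finally show ?thesis by (simp add: P_def Q_def mult.commute)
qed

text \<open>
  All classes having the same size \<open>K\<close>, the probability of a word depends on its letter counts only.
\<close>

lemma card_matching_perms:
  assumes J: "finite J" and K: "\<And>j. j \<in> J \<Longrightarrow> card {s\<in>{1..N}. col s = j} = K"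
    and w: "\<omega> \<in> {1..n} \<rightarrow> J" and nN: "n \<le> N" and nK: "n \<le> K"
  shows "real (card (matching_perms col N \<omega> n)) * (\<Prod>j\<in>J. fact (K - letter_count \<omega> n j))
     = fact (N - n) * fact K ^ card J"
  using w nN nK
proof (induction n)
  case 0
  have "matching_perms col N \<omega> 0 = {\<sigma>. \<sigma> permutes {1..N}}" by (simp add: matching_perms_def)
  then show ?case using card_permutations[of "{1..N}" N] by simp
next
  case (Suc n)
  let ?j = "\<omega> (Suc n)"
  define a where "a = letter_count \<omega> n ?j"
  have j: "?j \<in> J" using Suc.prems by auto
  have "a \<le> card {1..n}" unfolding a_def letter_count_def by (intro card_mono) auto
  then have aK: "a < K" using Suc.prems by simp
  have "K - a = Suc (K - Suc a)" using aK by simp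
  then have f: "fact (K - a) = real (K - a) * fact (K - Suc a)" by (metis fact_Suc of_nat_mult of_nat_fact)
  have "N - n = Suc (N - Suc n)" using Suc.prems by simp
  then have fN: "fact (N - n) = real (N - n) * fact (N - Suc n)" by (metis fact_Suc of_nat_mult of_nat_fact)
  define R where "R = (\<Prod>j\<in>J - {?j}. fact (K - letter_count \<omega> n j) :: real)"
  have 1: "(\<Prod>j\<in>J. fact (K - letter_count \<omega> n j)) = fact (K - a) * R"
    using prod.remove[OF J j] by (simp add: R_def a_def)
  have "(\<Prod>j\<in>J. fact (K - letter_count \<omega> (Suc n) j)) = fact (K - Suc a) * (\<Prod>j\<in>J - {?j}. fact (K - letter_count \<omega> (Suc n) j))"
    using prod.remove[OF J j, of "\<lambda>j. fact (K - letter_count \<omega> (Suc n) j)"] by (simp add: a_def letter_count_Suc)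
  also have "(\<Prod>j\<in>J - {?j}. fact (K - letter_count \<omega> (Suc n) j)) = R"
    unfolding R_def by (intro prod.cong refl) (auto simp: letter_count_Suc)
  finally have 2: "(\<Prod>j\<in>J. fact (K - letter_count \<omega> (Suc n) j)) = fact (K - Suc a) * R" .
  have "card (matching_perms col N \<omega> (Suc n)) * (N - n) = card (matching_perms col N \<omega> n) * (K - a)"
    unfolding a_def using Suc.prems K[OF j] by (intro matching_perms_step) auto
  then have 3: "real (card (matching_perms col N \<omega> (Suc n))) * real (N - n)
      = real (card (matching_perms col N \<omega> n)) * real (K - a)" by (metis of_nat_mult)
  have IH: "real (card (matching_perms col N \<omega> n)) * (fact (K - a) * R) = fact (N - n) * fact K ^ card J"
  proof -
    have "\<omega> \<in> {1..n} \<rightarrow> J" using Suc.prems(1) by (auto simp: Pi_iff)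
    then show ?thesis using Suc.IH Suc.prems(2,3) unfolding 1 by simp
  qed
  have "real (N - n) * (real (card (matching_perms col N \<omega> (Suc n))) * (fact (K - Suc a) * R))
      = (real (card (matching_perms col N \<omega> (Suc n))) * real (N - n)) * (fact (K - Suc a) * R)" by simp
  also have "\<dots> = real (card (matching_perms col N \<omega> n)) * (fact (K - a) * R)"
    unfolding 3 f by simp
  also have "\<dots> = real (N - n) * (fact (N - Suc n) * fact K ^ card J)" unfolding IH fN by simp
  finally show ?case using Suc.prems unfolding 2 by simp
qed

lemma suit_class_size:
  assumes m: "m > 0" and j: "j < m"
  shows "card {s\<in>{1..m * K}. s mod m = j} = K"
proof (induction K)
  case (Suc K)
  have "{s\<in>{1..m * Suc K}. s mod m = j} = {s\<in>{1..m * K}. s mod m = j} \<union> {s\<in>{m * K<..m * Suc K}. s mod m = j}"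
    by auto
  moreover have "{s\<in>{m * K<..m * Suc K}. s mod m = j} = {if j = 0 then m * Suc K else m * K + j}"
  proof (intro set_eqI iffI)
    fix s assume "s \<in> {s\<in>{m * K<..m * Suc K}. s mod m = j}"
    then have s: "m * K < s" "s \<le> m * K + m" "s mod m = j" by auto
    define u where "u = s - m * K"
    have u: "s = m * K + u" "0 < u" "u \<le> m" using s by (auto simp: u_def)
    have "u mod m = j" using s(3) unfolding u(1) by simp
    then show "s \<in> {if j = 0 then m * Suc K else m * K + j}"
      using u m by (cases "u = m") auto
  next
    fix s assume "s \<in> {if j = 0 then m * Suc K else m * K + j}"
    then show "s \<in> {s\<in>{m * K<..m * Suc K}. s mod m = j}"
      using j m by (auto split: if_splits)
  qed
  moreover have "card ({s\<in>{1..m * K}. s mod m = j} \<union> {s\<in>{m * K<..m * Suc K}. s mod m = j})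
     = card {s\<in>{1..m * K}. s mod m = j} + card {s\<in>{m * K<..m * Suc K}. s mod m = j}"
    by (rule card_Un_disjoint) auto
  ultimately show ?case using Suc.IH by simp
qed simp

section \<open>Total variation distance in terms of suit counts\<close>

lemma pmf_drawn_suits:
  assumes w: "\<omega> \<in> suit_words d n"
  shows "pmf (drawn_suits_pmf d n N) \<omega> = real (card (matching_perms (suit d) N \<omega> n)) / fact N"
proof -
  define S where "S = {\<sigma>. \<sigma> permutes {1..N}}"
  have "id \<in> S" using permutes_id[of "{1..N}"] by (simp add: S_def id_def)
  then have S: "S \<noteq> {}" by blast
  have S': "finite S" "card S = fact N"
    unfolding S_def by (auto intro!: finite_permutations card_permutations)
  have "drawn_suits d n \<sigma> = \<omega> \<longleftrightarrow> (\<forall>t\<in>{1..n}. suit d (\<sigma> t) = \<omega> t)" for \<sigma>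
    using w by (auto simp: drawn_suits_def suit_words_def PiE_def extensional_def fun_eq_iff)
  then have "S \<inter> drawn_suits d n -` {\<omega>} = matching_perms (suit d) N \<omega> n"
    by (auto simp: S_def matching_perms_def)
  then show ?thesis
    unfolding drawn_suits_pmf_def shuffle_pmf_def S_def[symmetric]
    using S S' by (simp add: pmf_map measure_pmf_of_set)
qed

text \<open>
  Both laws on words are constant on the words with given counts, so the total excess on such a class is the
  excess of the masses of the count vector.
\<close>

lemma card_words_times_excess:
  fixes d n K :: nat
  assumes d: "d > 0" and nK: "n \<le> K" and b: "sum b {0..<2 * d} = n"
  defines "J \<equiv> {0..<2 * d}" and "m \<equiv> 2 * d"
  shows "(\<Sum>\<omega> | \<omega> \<in> suit_words d n \<and> (\<forall>j\<in>J. letter_count \<omega> n j = b j).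
      max (pmf (drawn_suits_pmf d n (m * K)) \<omega> - 1 / real m ^ n) 0)
    = max (hypergeom_mass K J b - multinomial_mass J b) 0"
proof -
  define W where "W = {\<omega> \<in> suit_words d n. \<forall>j\<in>J. letter_count \<omega> n j = b j}"
  define p where "p = fact (m * K - n) * fact K ^ m / (fact (m * K) * (\<Prod>j\<in>J. fact (K - b j) :: real))"
  have m: "m > 0" and J: "finite J" and mJ: "card J = m" using d by (auto simp: m_def J_def)
  have "1 * K \<le> m * K" using m by (intro mult_right_mono) auto
  then have nN: "n \<le> m * K" using nK by linarith
  have bn: "sum b J = n" using b by (simp add: J_def)
  have bK: "b j \<le> K" if "j \<in> J" for j using member_le_sum[OF that, of b] J bn nK by simp
  have pm: "pmf (drawn_suits_pmf d n (m * K)) \<omega> = p" if w: "\<omega> \<in> W" for \<omega>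
  proof -
    have c: "card {s\<in>{1..m * K}. suit d s = j} = K" if "j \<in> J" for j
      unfolding suit_def m_def using that d by (intro suit_class_size) (auto simp: J_def)
    have "\<omega> \<in> {1..n} \<rightarrow> J" using w by (auto simp: W_def suit_words_def J_def)
    from card_matching_perms[OF J c this nN nK]
    have "real (card (matching_perms (suit d) (m * K) \<omega> n)) * (\<Prod>j\<in>J. fact (K - letter_count \<omega> n j))
     = fact (m * K - n) * fact K ^ m" by (simp add: mJ)
    also have "(\<Prod>j\<in>J. fact (K - letter_count \<omega> n j)) = (\<Prod>j\<in>J. fact (K - b j) :: real)"
      using w by (intro prod.cong refl) (auto simp: W_def)
    finally have "real (card (matching_perms (suit d) (m * K) \<omega> n))
        = fact (m * K - n) * fact K ^ m / (\<Prod>j\<in>J. fact (K - b j))"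
      using J by (simp add: field_simps)
    then show ?thesis using w by (simp add: W_def pmf_drawn_suits p_def)
  qed
  have cW: "real (card W) = fact n / (\<Prod>j\<in>J. fact (b j))"
    unfolding W_def suit_words_def J_def[symmetric] using card_words_letter_count[OF J bn] by simp
  have "(\<Sum>\<omega>\<in>W. max (pmf (drawn_suits_pmf d n (m * K)) \<omega> - 1 / real m ^ n) 0)
     = real (card W) * max (p - 1 / real m ^ n) 0"
    using pm by simp
  also have "\<dots> = max (real (card W) * p - real (card W) * (1 / real m ^ n)) 0"
    by (simp add: max_mult_distrib_left right_diff_distrib)
  also have "real (card W) * (1 / real m ^ n) = multinomial_mass J b"
    by (simp add: multinomial_mass_def cW bn mJ)
  also have "real (card W) * p = hypergeom_mass K J b"
  proof -
    have "(\<Prod>j\<in>J. real (K choose b j)) = (\<Prod>j\<in>J. fact K / (fact (b j) * fact (K - b j)))"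
      by (intro prod.cong refl binomial_fact bK)
    also have "\<dots> = fact K ^ m / ((\<Prod>j\<in>J. fact (b j)) * (\<Prod>j\<in>J. fact (K - b j)))"
      by (simp add: prod_dividef prod.distrib mJ)
    finally have 1: "(\<Prod>j\<in>J. real (K choose b j)) = fact K ^ m / ((\<Prod>j\<in>J. fact (b j)) * (\<Prod>j\<in>J. fact (K - b j)))" .
    show ?thesis unfolding hypergeom_mass_def bn mJ 1 binomial_fact[OF nN] cW p_def
      by (simp add: mult_ac)
  qed
  finally show ?thesis by (simp add: W_def)
qed

text \<open>
  The count vector has \<open>m - 1\<close> free coordinates, those of the suits \<open>1..<m\<close>. The count of suit \<open>0\<close> is
  determined by them and plays the part of the last coordinate of the hyperplane.
\<close>

definition all_counts :: "nat \<Rightarrow> nat \<Rightarrow> (nat \<Rightarrow> nat) \<Rightarrow> nat \<Rightarrow> nat"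
  where "all_counts m n k = k(0 := n - sum k {1..<m})"

definition count_vectors :: "nat \<Rightarrow> nat \<Rightarrow> (nat \<Rightarrow> nat) set"
  where "count_vectors m n = {k \<in> {1..<m} \<rightarrow>\<^sub>E {0..n}. sum k {1..<m} \<le> n}"

lemma finite_count_vectors: "finite (count_vectors m n)"
  unfolding count_vectors_def by (rule finite_subset[of _ "{1..<m} \<rightarrow>\<^sub>E {0..n}"]) (auto intro: finite_PiE)

lemma sum_all_counts:
  assumes "m > 0"
  shows "(\<Sum>j\<in>{0..<m}. f (all_counts m n k j)) = f (n - sum k {1..<m}) + (\<Sum>j\<in>{1..<m}. f (k j))"
proof -
  have "{0..<m} = insert 0 {1..<m}" using assms by auto
  then have "(\<Sum>j\<in>{0..<m}. f (all_counts m n k j)) = (\<Sum>j\<in>insert 0 {1..<m}. f (all_counts m n k j))"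
    by (rule arg_cong)
  also have "\<dots> = f (all_counts m n k 0) + (\<Sum>j\<in>{1..<m}. f (all_counts m n k j))"
    by (subst sum.insert) auto
  also have "(\<Sum>j\<in>{1..<m}. f (all_counts m n k j)) = (\<Sum>j\<in>{1..<m}. f (k j))"
    by (intro sum.cong refl) (auto simp: all_counts_def)
  finally show ?thesis by (simp add: all_counts_def)
qed

lemma sum_all_counts_total:
  assumes "m > 0" "k \<in> count_vectors m n"
  shows "sum (all_counts m n k) {0..<m} = n"
  using sum_all_counts[OF assms(1), of "\<lambda>x. x" n k] assms(2) by (simp add: count_vectors_def)

text \<open>
  Grouping the words by their suit counts turns the total variation distance on words into the one between
  the hypergeometric and the multinomial law.
\<close>

theorem tv_dist_counts:
  assumes d: "d > 0" and nK: "n \<le> K"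
  defines "m \<equiv> 2 * d"
  shows "tv_dist d n (m * K) = (\<Sum>k\<in>count_vectors m n.
     max (hypergeom_mass K {0..<m} (all_counts m n k) - multinomial_mass {0..<m} (all_counts m n k)) 0)"
proof -
  define g where "g = (\<lambda>\<omega> :: nat \<Rightarrow> nat. \<lambda>j\<in>{1..<m}. letter_count \<omega> n j)"
  define h where "h = (\<lambda>\<omega>. max (pmf (drawn_suits_pmf d n (m * K)) \<omega> - 1 / real m ^ n) 0)"
  have m: "m > 0" using d by (simp add: m_def)
  have ins: "{0..<m} = insert 0 {1..<m}" using m by auto
  have fin: "finite (suit_words d n)" unfolding suit_words_def by (intro finite_PiE) auto
  have tot: "letter_count \<omega> n 0 + (\<Sum>j\<in>{1..<m}. letter_count \<omega> n j) = n" if "\<omega> \<in> suit_words d n" for \<omega>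
  proof -
    have "(\<Sum>j\<in>{0..<m}. letter_count \<omega> n j) = n"
      using that by (intro sum_letter_count) (auto simp: suit_words_def m_def)
    then show ?thesis unfolding ins by (subst (asm) sum.insert) auto
  qed
  have gsum: "sum (g \<omega>) {1..<m} = (\<Sum>j\<in>{1..<m}. letter_count \<omega> n j)" for \<omega>
    by (intro sum.cong refl) (simp add: g_def)
  have "g ` suit_words d n \<subseteq> count_vectors m n"
  proof
    fix k assume "k \<in> g ` suit_words d n"
    then obtain \<omega> where w: "\<omega> \<in> suit_words d n" "k = g \<omega>" by blast
    have s: "sum k {1..<m} \<le> n" using tot[OF w(1)] gsum[of \<omega>] w(2) by simp
    have "k j \<le> n" if "j \<in> {1..<m}" for j
      using member_le_sum[OF that, of k] s by simp
    then show "k \<in> count_vectors m n" using s w(2) by (auto simp: count_vectors_def g_def)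
  qed
  then have "(\<Sum>\<omega>\<in>suit_words d n. h \<omega>) = (\<Sum>k\<in>count_vectors m n. \<Sum>\<omega> | \<omega> \<in> suit_words d n \<and> g \<omega> = k. h \<omega>)"
    using fin finite_count_vectors by (subst sum.group[of _ _ g]) auto
  also have "\<dots> = (\<Sum>k\<in>count_vectors m n.
     max (hypergeom_mass K {0..<m} (all_counts m n k) - multinomial_mass {0..<m} (all_counts m n k)) 0)"
  proof (intro sum.cong refl)
    fix k assume k: "k \<in> count_vectors m n"
    have "g \<omega> = k \<longleftrightarrow> (\<forall>j\<in>{0..<m}. letter_count \<omega> n j = all_counts m n k j)" if w: "\<omega> \<in> suit_words d n" for \<omega>
    proof
      assume gk: "g \<omega> = k"
      then have "letter_count \<omega> n 0 = n - sum k {1..<m}" using tot[OF w] gsum[of \<omega>] by simp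
      moreover have "letter_count \<omega> n j = k j" if "j \<in> {1..<m}" for j
        using that unfolding gk[symmetric] by (simp add: g_def)
      ultimately show "\<forall>j\<in>{0..<m}. letter_count \<omega> n j = all_counts m n k j"
        unfolding ins by (auto simp: all_counts_def)
    next
      assume a: "\<forall>j\<in>{0..<m}. letter_count \<omega> n j = all_counts m n k j"
      show "g \<omega> = k"
      proof
        fix j show "g \<omega> j = k j"
          using a k by (cases "j \<in> {1..<m}") (auto simp: g_def all_counts_def count_vectors_def PiE_def extensional_def)
      qed
    qed
    then have "{\<omega>. \<omega> \<in> suit_words d n \<and> g \<omega> = k}
        = {\<omega>. \<omega> \<in> suit_words d n \<and> (\<forall>j\<in>{0..<2 * d}. letter_count \<omega> n j = all_counts m n k j)}"
      unfolding m_def by blast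
    then show "(\<Sum>\<omega> | \<omega> \<in> suit_words d n \<and> g \<omega> = k. h \<omega>)
       = max (hypergeom_mass K {0..<m} (all_counts m n k) - multinomial_mass {0..<m} (all_counts m n k)) 0"
      using card_words_times_excess[OF d nK, of "all_counts m n k"] sum_all_counts_total[OF m k]
      unfolding h_def m_def by simp
  qed
  finally show ?thesis by (simp add: tv_dist_def h_def m_def)
qed

section \<open>The integral over the hyperplane and the lattice cells\<close>

text \<open>
  Squared Euclidean norm of the point of the hyperplane with first coordinates \<open>x\<close>.
\<close>

definition plane_norm_sq :: "nat \<Rightarrow> (nat \<Rightarrow> real) \<Rightarrow> real"
  where "plane_norm_sq m x = (\<Sum>i\<in>{1..<m}. (x i)\<^sup>2) + (\<Sum>i\<in>{1..<m}. x i)\<^sup>2"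

abbreviation lborel_coords :: "nat \<Rightarrow> (nat \<Rightarrow> real) measure"
  where "lborel_coords m \<equiv> (\<Pi>\<^sub>M i\<in>{1..<m}. lborel)"

lemma plane_norm_sq_nonneg: "plane_norm_sq m x \<ge> 0"
  by (simp add: plane_norm_sq_def sum_nonneg)

lemma L2_set_complete_point:
  assumes "m > 0"
  shows "(L2_set (complete_point m x) {1..m})\<^sup>2 = plane_norm_sq m x"
proof -
  have e: "{1..m} = insert m {1..<m}" using assms by auto
  have "(\<Sum>i\<in>{1..m}. (complete_point m x i)\<^sup>2) = plane_norm_sq m x"
    unfolding e by (subst sum.insert) (auto simp: complete_point_def plane_norm_sq_def)
  then show ?thesis unfolding L2_set_def by (simp add: plane_norm_sq_nonneg)
qed

lemma gauss_diff_eq_profile: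
  assumes d: "d \<ge> 1" and c: "c > 1"
  shows "gauss_diff d c (complete_point (2 * d) x) = gauss_profile (real (2 * d)) c (plane_norm_sq (2 * d) x)"
proof -
  define s where "s = plane_norm_sq (2 * d) x"
  have d0: "real d > 0" using d by simp
  have l2: "(L2_set (complete_point (2 * d) x) {1..2 * d})\<^sup>2 = s"
    unfolding s_def using d by (intro L2_set_complete_point) simp
  have "pi powr (1 / 2 - real d) * 2 powr (3 / 2 - 2 * real d) * real d powr (1 - real d)
     = exp ((1 / 2 - real d) * ln pi + (3 / 2 - 2 * real d) * ln 2 + (1 - real d) * ln (real d))"
    using d0 by (simp add: powr_def exp_add)
  also have "(1 / 2 - real d) * ln pi + (3 / 2 - 2 * real d) * ln 2 + (1 - real d) * ln (real d)
     = gauss_ln_const (real (2 * d))"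
    using d0 by (simp add: gauss_ln_const_def ln_mult field_simps)
  finally have 1: "pi powr (1 / 2 - real d) * 2 powr (3 / 2 - 2 * real d) * real d powr (1 - real d)
     = exp (gauss_ln_const (real (2 * d)))" .
  have 2: "(c / (c - 1)) powr (real d - 1 / 2) * exp (- (c * s / (4 * real d * (c - 1))))
     = exp ((real (2 * d) - 1) / 2 * ln (c / (c - 1)) - c * s / (2 * real (2 * d) * (c - 1)))"
    using c by (simp add: powr_def exp_add[symmetric] diff_divide_distrib)
  show ?thesis
    unfolding gauss_diff_def l2 1 2 gauss_profile_def s_def[symmetric] by simp
qed

lemma complete_point_in_region_iff:
  assumes d: "d \<ge> 1" and c: "c > 1" and x: "x \<in> {1..<2 * d} \<rightarrow>\<^sub>E UNIV"
  shows "complete_point (2 * d) x \<in> closed_ball (2 * d) (radius d c) \<inter> zero_sum_plane (2 * d)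
     \<longleftrightarrow> gauss_profile (real (2 * d)) c (plane_norm_sq (2 * d) x) \<ge> 0"
proof -
  define m where "m = 2 * d"
  have m: "m > 0" using d by (simp add: m_def)
  have e: "{1..m} = insert m {1..<m}" using m by auto
  have ext: "complete_point m x \<in> {1..m} \<rightarrow>\<^sub>E UNIV"
    using x m by (auto simp: complete_point_def m_def PiE_def extensional_def)
  have zero: "(\<Sum>i=1..m. complete_point m x i) = 0"
    unfolding e by (subst sum.insert) (auto simp: complete_point_def)
  define r2 where "r2 = real m * (real m - 1) * (c - 1) * ln (c / (c - 1))"
  have "ln (c / (c - 1)) \<ge> 0" using c by (intro ln_ge_zero) (simp add: field_simps)
  then have r0: "r2 \<ge> 0" using c m unfolding r2_def by (intro mult_nonneg_nonneg) auto
  have rad: "radius d c = sqrt r2"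
    unfolding radius_def r2_def m_def by (simp add: power2_eq_square algebra_simps)
  have "L2_set (complete_point m x) {1..m} \<le> sqrt r2 \<longleftrightarrow> (L2_set (complete_point m x) {1..m})\<^sup>2 \<le> (sqrt r2)\<^sup>2"
    using r0 by (simp only: power_mono_iff[OF L2_set_nonneg real_sqrt_ge_zero])
  also have "\<dots> \<longleftrightarrow> plane_norm_sq m x \<le> r2" by (simp only: L2_set_complete_point[OF m] real_sqrt_pow2[OF r0])
  also have "\<dots> \<longleftrightarrow> gauss_profile (real m) c (plane_norm_sq m x) \<ge> 0"
    using gauss_profile_nonneg_iff[of "real m" c] m c by (simp add: r2_def)
  finally show ?thesis
    using ext zero unfolding closed_ball_def zero_sum_plane_def rad m_def[symmetric] by simp
qed

text \<open>
  Integrating over the ball is integrating the positive part over the whole hyperplane, because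
  the ball is the region where the integrand is nonnegative. The positive part is Lipschitz
  in \<open>\<parallel>X\<parallel>\<^sup>2\<close>, which makes its Riemann sums converge with a rate.
\<close>

lemma plane_integral_eq_profile:
  assumes d: "d \<ge> 1" and c: "c > 1"
  shows "plane_integral (2 * d) (closed_ball (2 * d) (radius d c) \<inter> zero_sum_plane (2 * d)) (gauss_diff d c)
     = (LINT x|lborel_coords (2 * d). max (gauss_profile (real (2 * d)) c (plane_norm_sq (2 * d) x)) 0)"
  unfolding plane_integral_def Let_def set_lebesgue_integral_def
proof (intro Bochner_Integration.integral_cong refl)
  fix x assume x: "x \<in> space (lborel_coords (2 * d))"
  then have "x \<in> {1..<2 * d} \<rightarrow>\<^sub>E UNIV" by (simp add: space_PiM)
  note iff = complete_point_in_region_iff[OF d c this]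
  show "indicator {x \<in> space (lborel_coords (2 * d)). complete_point (2 * d) x
        \<in> closed_ball (2 * d) (radius d c) \<inter> zero_sum_plane (2 * d)} x *\<^sub>R gauss_diff d c (complete_point (2 * d) x)
     = max (gauss_profile (real (2 * d)) c (plane_norm_sq (2 * d) x)) 0"
    using x iff by (auto simp: gauss_diff_eq_profile[OF d c] indicator_def max_def)
qed

lemma exp_lipschitz_below:
  fixes u v B :: real
  assumes "u \<le> B" "v \<le> B"
  shows "\<bar>exp u - exp v\<bar> \<le> exp B * \<bar>u - v\<bar>"
proof -
  have *: "exp u - exp v \<le> exp B * (u - v)" if "v \<le> u" "u \<le> B" for u v :: real
  proof -
    have "exp u - exp v = exp u * (1 - exp (v - u))" by (simp add: exp_diff algebra_simps)
    also have "1 - exp (v - u) \<le> u - v" using exp_ge_add_one_self[of "v - u"] by linarith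
    then have "exp u * (1 - exp (v - u)) \<le> exp u * (u - v)" by (intro mult_left_mono) auto
    also have "\<dots> \<le> exp B * (u - v)" using that by (intro mult_right_mono) auto
    finally show ?thesis .
  qed
  show ?thesis
  proof (cases "v \<le> u")
    case True
    then show ?thesis using *[OF True assms(1)] by simp
  next
    case False
    then have "exp u \<le> exp v" by simp
    then show ?thesis using *[of u v] False assms(2) by simp
  qed
qed

lemma gauss_profile_lipschitz:
  assumes m: "m > 0" and c: "c > 1"
  shows "\<exists>L\<ge>0. \<forall>s\<ge>0. \<forall>t\<ge>0. \<bar>gauss_profile m c s - gauss_profile m c t\<bar> \<le> L * \<bar>s - t\<bar>"
proof -
  define A where "A = (m - 1) / 2 * ln (c / (c - 1))"
  define p where "p = c / (2 * m * (c - 1))"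
  define q where "q = 1 / (2 * m)"
  have pq: "p \<ge> 0" "q \<ge> 0" using m c by (auto simp: p_def q_def)
  have g: "gauss_profile m c s = exp (gauss_ln_const m) * (exp (A - p * s) - exp (- (q * s)))" for s
    by (simp add: gauss_profile_def A_def p_def q_def)
  define L where "L = exp (gauss_ln_const m) * (exp A * p + exp 0 * q)"
  show ?thesis
  proof (intro exI[of _ L] conjI allI impI)
    show "L \<ge> 0" using pq by (simp add: L_def)
    fix s t :: real assume s: "s \<ge> 0" and t: "t \<ge> 0"
    have "\<bar>exp (A - p * s) - exp (A - p * t)\<bar> \<le> exp A * \<bar>(A - p * s) - (A - p * t)\<bar>"
      using s t pq by (intro exp_lipschitz_below) auto
    also have "\<bar>(A - p * s) - (A - p * t)\<bar> = p * \<bar>s - t\<bar>"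
    proof -
      have "(A - p * s) - (A - p * t) = p * (t - s)" by (simp add: algebra_simps)
      then show ?thesis using pq by (simp add: abs_mult abs_minus_commute)
    qed
    finally have 1: "\<bar>exp (A - p * s) - exp (A - p * t)\<bar> \<le> exp A * (p * \<bar>s - t\<bar>)" .
    have "\<bar>exp (- (q * s)) - exp (- (q * t))\<bar> \<le> exp 0 * \<bar>- (q * s) - - (q * t)\<bar>"
      using s t pq by (intro exp_lipschitz_below) auto
    also have "\<bar>- (q * s) - - (q * t)\<bar> = q * \<bar>s - t\<bar>"
    proof -
      have "- (q * s) - - (q * t) = q * (t - s)" by (simp add: algebra_simps)
      then show ?thesis using pq by (simp add: abs_mult abs_minus_commute)
    qed
    finally have 2: "\<bar>exp (- (q * s)) - exp (- (q * t))\<bar> \<le> exp 0 * (q * \<bar>s - t\<bar>)" .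
    have "gauss_profile m c s - gauss_profile m c t = exp (gauss_ln_const m) *
        ((exp (A - p * s) - exp (A - p * t)) - (exp (- (q * s)) - exp (- (q * t))))"
      unfolding g by (simp add: algebra_simps)
    then have "\<bar>gauss_profile m c s - gauss_profile m c t\<bar> = exp (gauss_ln_const m) *
        \<bar>(exp (A - p * s) - exp (A - p * t)) - (exp (- (q * s)) - exp (- (q * t)))\<bar>"
      by (simp add: abs_mult)
    also have "\<dots> \<le> exp (gauss_ln_const m) * (exp A * (p * \<bar>s - t\<bar>) + exp 0 * (q * \<bar>s - t\<bar>))"
      by (intro mult_left_mono) (use 1 2 in linarith, simp)
    also have "\<dots> = L * \<bar>s - t\<bar>" by (simp add: L_def algebra_simps)
    finally show "\<bar>gauss_profile m c s - gauss_profile m c t\<bar> \<le> L * \<bar>s - t\<bar>" .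
  qed
qed

lemma gauss_profile_le:
  assumes m: "m > 0" and c: "c > 1" and s: "s \<ge> 0"
  shows "gauss_profile m c s \<le> exp (gauss_ln_const m) * exp ((m - 1) / 2 * ln (c / (c - 1)))"
proof -
  have "c * s / (2 * m * (c - 1)) \<ge> 0" using assms by auto
  then have "exp ((m - 1) / 2 * ln (c / (c - 1)) - c * s / (2 * m * (c - 1))) \<le> exp ((m - 1) / 2 * ln (c / (c - 1)))"
    by (subst exp_le_cancel_iff) linarith
  then show ?thesis
    unfolding gauss_profile_def by (intro mult_left_mono) (simp_all add: add_increasing2 diff_le_eq)
qed

definition lattice_point :: "nat \<Rightarrow> nat \<Rightarrow> (nat \<Rightarrow> nat) \<Rightarrow> nat \<Rightarrow> real"
  where "lattice_point m n k i = (real m * real (k i) - real n) / sqrt (real n)"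

text \<open>
  Half-open cubes of side \<open>m / sqrt n\<close> with the rescaled count vectors as lower corners.
\<close>

definition cell :: "nat \<Rightarrow> nat \<Rightarrow> (nat \<Rightarrow> nat) \<Rightarrow> (nat \<Rightarrow> real) set"
  where "cell m n k = (\<Pi>\<^sub>E i\<in>{1..<m}. {lattice_point m n k i..<lattice_point m n k i + real m / sqrt (real n)})"

lemma dispersion_all_counts:
  assumes m: "m > 0" and n: "n > 0" and k: "k \<in> count_vectors m n"
  shows "dispersion {0..<m} (all_counts m n k) = plane_norm_sq m (lattice_point m n k)"
proof -
  have kn: "sum k {1..<m} \<le> n" using k by (simp add: count_vectors_def)
  have "real m * real (n - sum k {1..<m}) - real n = - (\<Sum>i\<in>{1..<m}. real m * real (k i) - real n)"
  proof -
    have a: "(\<Sum>i\<in>{1..<m}. real m * real (k i) - real n) = real m * (\<Sum>i\<in>{1..<m}. real (k i)) - real (m - 1) * real n"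
      by (simp add: sum_subtractf sum_distrib_left)
    have b: "real (n - sum k {1..<m}) = real n - (\<Sum>i\<in>{1..<m}. real (k i))"
      using kn by (simp add: of_nat_diff)
    have c: "real (m - 1) = real m - 1" using m by (simp add: of_nat_diff)
    show ?thesis unfolding a b c by (simp add: algebra_simps)
  qed
  then have 1: "(real m * real (n - sum k {1..<m}) - real n)\<^sup>2 = (\<Sum>i\<in>{1..<m}. real m * real (k i) - real n)\<^sup>2"
    by simp
  have "dispersion {0..<m} (all_counts m n k)
     = ((real m * real (n - sum k {1..<m}) - real n)\<^sup>2 + (\<Sum>i\<in>{1..<m}. (real m * real (k i) - real n)\<^sup>2)) / real n"
    unfolding dispersion_def sum_all_counts_total[OF m k]
    using sum_all_counts[OF m, of "\<lambda>x. (real m * real x - real n)\<^sup>2" n k] by simp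
  also have "\<dots> = plane_norm_sq m (lattice_point m n k)"
    unfolding 1 plane_norm_sq_def lattice_point_def
    by (simp add: power_divide sum_divide_distrib[symmetric] add_divide_distrib)
  finally show ?thesis .
qed

lemma PiE_interval_in_sets:
  "(\<Pi>\<^sub>E i\<in>{1..<m}. {a i..<b i}) \<in> sets (lborel_coords m)"
  "(\<Pi>\<^sub>E i\<in>{1..<m}. {a i..b i}) \<in> sets (lborel_coords m)"
  by (auto intro!: sets_PiM_I_finite)

lemma emeasure_cell:
  assumes n: "n > 0"
  shows "emeasure (lborel_coords m) (cell m n k) = ennreal ((real m / sqrt (real n)) ^ (m - 1))"
proof -
  interpret product_sigma_finite "\<lambda>_::nat. lborel :: real measure" ..
  have "emeasure (lborel_coords m) (cell m n k) = (\<Prod>i\<in>{1..<m}. ennreal (real m / sqrt (real n)))"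
    unfolding cell_def by (subst emeasure_PiM) auto
  then show ?thesis by (simp add: ennreal_power)
qed

lemma emeasure_cube:
  assumes R: "R \<ge> 0"
  shows "emeasure (lborel_coords m) (\<Pi>\<^sub>E i\<in>{1..<m}. {- R..R}) = ennreal ((2 * R) ^ (m - 1))"
proof -
  interpret product_sigma_finite "\<lambda>_::nat. lborel :: real measure" ..
  have "emeasure (lborel_coords m) (\<Pi>\<^sub>E i\<in>{1..<m}. {- R..R}) = (\<Prod>i\<in>{1..<m}. ennreal (2 * R))"
    using R by (subst emeasure_PiM) auto
  then show ?thesis using R by (simp add: ennreal_power)
qed

definition cell_index :: "nat \<Rightarrow> nat \<Rightarrow> (nat \<Rightarrow> real) \<Rightarrow> nat \<Rightarrow> nat"
  where "cell_index m n x = (\<lambda>i\<in>{1..<m}. nat \<lfloor>(real n + sqrt (real n) * x i) / real m\<rfloor>)"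

lemma in_cell_unique:
  assumes m: "m > 0" and n: "n > 0" and k: "k \<in> count_vectors m n" and x: "x \<in> cell m n k"
  shows "k = cell_index m n x"
proof
  fix i
  show "k i = cell_index m n x i"
  proof (cases "i \<in> {1..<m}")
    case True
    define w where "w = sqrt (real n)"
    have w: "w > 0" using n by (simp add: w_def)
    have xi: "(real m * real (k i) - real n) / w \<le> x i" "x i < (real m * real (k i) - real n) / w + real m / w"
      using x True by (auto simp: cell_def lattice_point_def w_def PiE_def Pi_def)
    have "real m * real (k i) - real n \<le> w * x i"
      using xi(1) w by (simp add: divide_le_eq mult.commute)
    moreover have "w * x i < real m * real (k i) - real n + real m"
      using xi(2) w by (simp add: add_divide_distrib[symmetric] less_divide_eq mult.commute)
    ultimately have "real (k i) \<le> (real n + w * x i) / real m" "(real n + w * x i) / real m < real (k i) + 1"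
      using m by (auto simp: field_simps)
    then have "\<lfloor>(real n + w * x i) / real m\<rfloor> = int (k i)" by (simp add: floor_eq_iff)
    then show ?thesis using True by (simp add: cell_index_def w_def)
  next
    case False
    then show ?thesis using k by (auto simp: cell_index_def count_vectors_def PiE_def extensional_def)
  qed
qed

text \<open>
  Every point with \<open>\<parallel>X\<parallel>\<^sup>2 \<le> n\<close> is covered: its coordinates are at least \<open>- sqrt n\<close>, so the rounded
  counts are natural numbers, and the sum of its coordinates is at most \<open>sqrt n\<close>, so they add up to
  at most \<open>n\<close>.
\<close>

lemma in_own_cell:
  assumes m: "m > 0" and n: "n > 0" and S: "plane_norm_sq m x \<le> S" "S \<le> real n"
    and x: "x \<in> {1..<m} \<rightarrow>\<^sub>E UNIV"
  shows "cell_index m n x \<in> count_vectors m n" "x \<in> cell m n (cell_index m n x)"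
proof -
  define w where "w = sqrt (real n)"
  have w: "w > 0" "w * w = real n" using n by (auto simp: w_def)
  define k where "k = cell_index m n x"
  have xw: "\<bar>x i\<bar> \<le> w" if "i \<in> {1..<m}" for i
  proof -
    have "(x i)\<^sup>2 \<le> (\<Sum>i\<in>{1..<m}. (x i)\<^sup>2)" by (rule member_le_sum[OF that]) auto
    also have "\<dots> \<le> plane_norm_sq m x" by (simp add: plane_norm_sq_def)
    finally show ?thesis using S unfolding w_def by (intro real_le_rsqrt) simp
  qed
  have "(\<Sum>i\<in>{1..<m}. x i)\<^sup>2 \<le> plane_norm_sq m x" by (simp add: plane_norm_sq_def sum_nonneg)
  then have sw: "(\<Sum>i\<in>{1..<m}. x i) \<le> w" using S unfolding w_def by (intro real_le_rsqrt) simp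
  have ki: "real (k i) \<le> (real n + w * x i) / real m \<and> (real n + w * x i) / real m < real (k i) + 1"
    if i: "i \<in> {1..<m}" for i
  proof -
    have "w * (- w) \<le> w * x i" using xw[OF i] w by (intro mult_left_mono) auto
    then have "real n + w * x i \<ge> 0" using w by simp
    then have "(real n + w * x i) / real m \<ge> 0" by simp
    then have "real (k i) = of_int \<lfloor>(real n + w * x i) / real m\<rfloor>"
      using i by (simp add: k_def cell_index_def w_def)
    then show ?thesis by linarith
  qed
  have "(\<Sum>i\<in>{1..<m}. real (k i)) \<le> (\<Sum>i\<in>{1..<m}. (real n + w * x i) / real m)"
    using ki by (intro sum_mono) auto
  also have "\<dots> = (real (m - 1) * real n + w * (\<Sum>i\<in>{1..<m}. x i)) / real m"
    by (simp add: sum_divide_distrib[symmetric] sum.distrib sum_distrib_left)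
  also have "\<dots> \<le> (real (m - 1) * real n + w * w) / real m"
    using sw w by (intro divide_right_mono add_left_mono mult_left_mono) auto
  also have "\<dots> = real n" using m by (simp add: w of_nat_diff field_simps)
  finally have "real (sum k {1..<m}) \<le> real n" by simp
  then have s: "sum k {1..<m} \<le> n" by (simp only: of_nat_le_iff)
  have "k i \<le> n" if "i \<in> {1..<m}" for i using member_le_sum[OF that, of k] s by simp
  then show "cell_index m n x \<in> count_vectors m n"
    using s unfolding k_def[symmetric] by (auto simp: count_vectors_def k_def cell_index_def)
  have "(real m * real (k i) - real n) / w \<le> x i \<and> x i < (real m * real (k i) - real n) / w + real m / w"
    if "i \<in> {1..<m}" for i
  proof -
    have "real m * real (k i) - real n \<le> w * x i" "w * x i < real m * real (k i) - real n + real m"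
      using ki[OF that] m by (auto simp: field_simps)
    then show ?thesis
      using w by (simp add: add_divide_distrib[symmetric] divide_le_eq less_divide_eq mult.commute)
  qed
  then show "x \<in> cell m n (cell_index m n x)"
    using x unfolding k_def[symmetric] cell_def lattice_point_def w_def by (auto simp: PiE_def)
qed

lemma plane_norm_sq_lipschitz:
  assumes xy: "\<And>i. i \<in> {1..<m} \<Longrightarrow> \<bar>x i - y i\<bar> \<le> \<delta>"
    and R: "\<And>i. i \<in> {1..<m} \<Longrightarrow> \<bar>x i\<bar> \<le> R" "\<And>i. i \<in> {1..<m} \<Longrightarrow> \<bar>y i\<bar> \<le> R"
    and \<delta>: "\<delta> \<ge> 0" "R \<ge> 0"
  shows "\<bar>plane_norm_sq m x - plane_norm_sq m y\<bar> \<le> 2 * R * (real m + (real m)\<^sup>2) * \<delta>"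
proof -
  let ?I = "{1..<m}"
  have sm: "(\<Sum>i\<in>?I. a) \<le> real m * a" if "a \<ge> 0" for a :: real
    using that by (simp add: mult_right_mono)
  have "(x i)\<^sup>2 - (y i)\<^sup>2 = (x i - y i) * (x i + y i)" for i by (simp add: power2_eq_square algebra_simps)
  moreover have "\<bar>(x i - y i) * (x i + y i)\<bar> \<le> \<delta> * (2 * R)" if "i \<in> ?I" for i
    unfolding abs_mult using xy[OF that] R(1)[OF that] R(2)[OF that] by (intro mult_mono) auto
  ultimately have "\<bar>(x i)\<^sup>2 - (y i)\<^sup>2\<bar> \<le> \<delta> * (2 * R)" if "i \<in> ?I" for i using that by simp
  then have "(\<Sum>i\<in>?I. \<bar>(x i)\<^sup>2 - (y i)\<^sup>2\<bar>) \<le> (\<Sum>i\<in>?I. \<delta> * (2 * R))" by (intro sum_mono) auto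
  also have "\<dots> \<le> real m * (\<delta> * (2 * R))" using \<delta> by (intro sm) auto
  finally have 1: "\<bar>(\<Sum>i\<in>?I. (x i)\<^sup>2) - (\<Sum>i\<in>?I. (y i)\<^sup>2)\<bar> \<le> real m * (\<delta> * (2 * R))"
    using sum_abs[of "\<lambda>i. (x i)\<^sup>2 - (y i)\<^sup>2" ?I] by (simp add: sum_subtractf)
  have "(\<Sum>i\<in>?I. \<bar>x i - y i\<bar>) \<le> (\<Sum>i\<in>?I. \<delta>)" using xy by (intro sum_mono)
  also have "\<dots> \<le> real m * \<delta>" using \<delta> by (intro sm)
  finally have a: "\<bar>sum x ?I - sum y ?I\<bar> \<le> real m * \<delta>"
    using sum_abs[of "\<lambda>i. x i - y i" ?I] by (simp add: sum_subtractf)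
  have "(\<Sum>i\<in>?I. \<bar>x i + y i\<bar>) \<le> (\<Sum>i\<in>?I. 2 * R)"
    using R by (intro sum_mono) (smt (verit))
  also have "\<dots> \<le> real m * (2 * R)" using \<delta> by (intro sm) auto
  finally have b: "\<bar>sum x ?I + sum y ?I\<bar> \<le> real m * (2 * R)"
    using sum_abs[of "\<lambda>i. x i + y i" ?I] by (simp add: sum.distrib)
  have "(sum x ?I)\<^sup>2 - (sum y ?I)\<^sup>2 = (sum x ?I - sum y ?I) * (sum x ?I + sum y ?I)"
    by (simp add: power2_eq_square algebra_simps)
  then have "\<bar>(sum x ?I)\<^sup>2 - (sum y ?I)\<^sup>2\<bar> \<le> (real m * \<delta>) * (real m * (2 * R))"
    using a b \<delta> by (simp only: abs_mult) (intro mult_mono; simp)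
  then have "\<bar>plane_norm_sq m x - plane_norm_sq m y\<bar> \<le> real m * (\<delta> * (2 * R)) + (real m * \<delta>) * (real m * (2 * R))"
    using 1 unfolding plane_norm_sq_def by linarith
  also have "\<dots> = 2 * R * (real m + (real m)\<^sup>2) * \<delta>" by (simp add: power2_eq_square algebra_simps)
  finally show ?thesis .
qed

section \<open>Comparison of the sum with the integral\<close>

definition step_function :: "nat \<Rightarrow> nat \<Rightarrow> ((nat \<Rightarrow> nat) \<Rightarrow> real) \<Rightarrow> (nat \<Rightarrow> real) \<Rightarrow> real"
  where "step_function m n a x = (\<Sum>k\<in>count_vectors m n. a k * indicator (cell m n k) x)"

lemma step_function_eq:
  assumes "m > 0" "n > 0"
  shows "step_function m n a x =
    (if cell_index m n x \<in> count_vectors m n \<and> x \<in> cell m n (cell_index m n x) then a (cell_index m n x) else 0)"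
proof -
  let ?k = "cell_index m n x"
  have "step_function m n a x = (\<Sum>k\<in>count_vectors m n. if ?k = k then a ?k * indicator (cell m n ?k) x else 0)"
    unfolding step_function_def
  proof (intro sum.cong refl)
    fix k assume "k \<in> count_vectors m n"
    then show "a k * indicator (cell m n k) x = (if ?k = k then a ?k * indicator (cell m n ?k) x else 0)"
      using in_cell_unique[OF assms, of k x] by (cases "x \<in> cell m n k") auto
  qed
  also have "\<dots> = (if ?k \<in> count_vectors m n then a ?k * indicator (cell m n ?k) x else 0)"
    by (rule sum.delta'[OF finite_count_vectors])
  finally show ?thesis by (simp add: indicator_def)
qed

text \<open>
  With \<open>a k\<close> the mass of \<open>k\<close> divided by the volume of its cell, this integral is the sum of the masses.
\<close>

lemma integral_step_function:
  assumes n: "n > 0"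
  shows "integrable (lborel_coords m) (step_function m n a)"
    and "(LINT x|lborel_coords m. step_function m n a x)
       = (\<Sum>k\<in>count_vectors m n. a k * (real m / sqrt (real n)) ^ (m - 1))"
proof -
  have set: "cell m n k \<in> sets (lborel_coords m)" for k unfolding cell_def by (rule PiE_interval_in_sets)
  have int: "integrable (lborel_coords m) (\<lambda>x. a k * indicator (cell m n k) x)" for k
    using set emeasure_cell[OF n, of m k] by (intro integrable_mult_right integrable_real_indicator) auto
  have meas: "measure (lborel_coords m) (cell m n k) = (real m / sqrt (real n)) ^ (m - 1)" for k
    unfolding measure_def emeasure_cell[OF n] by simp
  show "integrable (lborel_coords m) (step_function m n a)"
    unfolding step_function_def by (intro Bochner_Integration.integrable_sum int)
  have "(LINT x|lborel_coords m. step_function m n a x)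
      = (\<Sum>k\<in>count_vectors m n. LINT x|lborel_coords m. a k * indicator (cell m n k) x)"
    unfolding step_function_def by (intro Bochner_Integration.integral_sum int)
  also have "\<dots> = (\<Sum>k\<in>count_vectors m n. a k * measure (lborel_coords m) (cell m n k))"
    using set by (simp add: Int_absorb2 sets.sets_into_space)
  finally show "(LINT x|lborel_coords m. step_function m n a x)
       = (\<Sum>k\<in>count_vectors m n. a k * (real m / sqrt (real n)) ^ (m - 1))" by (simp only: meas)
qed

lemma abs_coord_le_plane_norm:
  assumes i: "i \<in> {1..<m}"
  shows "\<bar>x i\<bar> \<le> sqrt (plane_norm_sq m x)"
proof -
  have "(x i)\<^sup>2 \<le> (\<Sum>i\<in>{1..<m}. (x i)\<^sup>2)" by (rule member_le_sum[OF i]) auto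
  also have "\<dots> \<le> plane_norm_sq m x" by (simp add: plane_norm_sq_def)
  finally show ?thesis by (intro real_le_rsqrt) simp
qed

lemma borel_measurable_plane_norm_sq: "plane_norm_sq m \<in> borel_measurable (lborel_coords m)"
proof -
  have "(\<lambda>x. x i) \<in> borel_measurable (lborel_coords m)" if "i \<in> {1..<m}" for i
    using measurable_component_singleton[OF that, of "\<lambda>_. lborel :: real measure"] by simp
  then have "(\<lambda>x. (\<Sum>i\<in>{1..<m}. (x i)\<^sup>2) + (\<Sum>i\<in>{1..<m}. x i)\<^sup>2) \<in> borel_measurable (lborel_coords m)"
    by (intro borel_measurable_add borel_measurable_power borel_measurable_sum)
  then show ?thesis unfolding plane_norm_sq_def[abs_def] .
qed

lemma integrable_cube_bound:
  assumes R: "R \<ge> 0"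
  shows "integrable (lborel_coords m) (\<lambda>x. B * indicator (\<Pi>\<^sub>E i\<in>{1..<m}. {- R..R}) x :: real)"
    and "(LINT x|lborel_coords m. B * indicator (\<Pi>\<^sub>E i\<in>{1..<m}. {- R..R}) x) = B * (2 * R) ^ (m - 1)"
proof -
  let ?Q = "\<Pi>\<^sub>E i\<in>{1..<m}. {- R..R}"
  have set: "?Q \<in> sets (lborel_coords m)" by (rule PiE_interval_in_sets)
  show "integrable (lborel_coords m) (\<lambda>x. B * indicator ?Q x :: real)"
    using set emeasure_cube[OF R, of m] by (intro integrable_mult_right integrable_real_indicator) auto
  have "measure (lborel_coords m) ?Q = (2 * R) ^ (m - 1)"
    unfolding measure_def emeasure_cube[OF R] using R by simp
  then show "(LINT x|lborel_coords m. B * indicator ?Q x) = B * (2 * R) ^ (m - 1)"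
    using set by (simp add: Int_absorb2 sets.sets_into_space)
qed

lemma integrable_profile:
  assumes m: "m > 0" and c: "c > 1" and S: "S \<ge> 0" "\<And>s. s > S \<Longrightarrow> gauss_profile (real m) c s \<le> 0"
  shows "integrable (lborel_coords m) (\<lambda>x. max (gauss_profile (real m) c (plane_norm_sq m x)) 0)"
proof (rule Bochner_Integration.integrable_bound)
  define B where "B = exp (gauss_ln_const (real m)) * exp ((real m - 1) / 2 * ln (c / (c - 1)))"
  show "integrable (lborel_coords m) (\<lambda>x. B * indicator (\<Pi>\<^sub>E i\<in>{1..<m}. {- sqrt S..sqrt S}) x)"
    using S by (intro integrable_cube_bound) simp
  show "(\<lambda>x. max (gauss_profile (real m) c (plane_norm_sq m x)) 0) \<in> borel_measurable (lborel_coords m)"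
    unfolding gauss_profile_def using borel_measurable_plane_norm_sq[of m] by measurable
  show "AE x in lborel_coords m. norm (max (gauss_profile (real m) c (plane_norm_sq m x)) 0)
      \<le> norm (B * indicator (\<Pi>\<^sub>E i\<in>{1..<m}. {- sqrt S..sqrt S}) x)"
  proof (rule AE_I2)
    fix x assume "x \<in> space (lborel_coords m)"
    then have x: "x \<in> {1..<m} \<rightarrow>\<^sub>E UNIV" by (simp add: space_PiM)
    show "norm (max (gauss_profile (real m) c (plane_norm_sq m x)) 0)
      \<le> norm (B * indicator (\<Pi>\<^sub>E i\<in>{1..<m}. {- sqrt S..sqrt S}) x)"
    proof (cases "plane_norm_sq m x \<le> S")
      case True
      have "\<bar>x i\<bar> \<le> sqrt S" if "i \<in> {1..<m}" for i
        using abs_coord_le_plane_norm[OF that, of x] True real_sqrt_le_mono[OF True] by linarith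
      then have "x \<in> (\<Pi>\<^sub>E i\<in>{1..<m}. {- sqrt S..sqrt S})"
        using x by (auto simp: PiE_def Pi_def abs_le_iff minus_le_iff)
      moreover have "gauss_profile (real m) c (plane_norm_sq m x) \<le> B"
        unfolding B_def using m c by (intro gauss_profile_le plane_norm_sq_nonneg) auto
      moreover have "B \<ge> 0" by (simp add: B_def)
      ultimately show ?thesis by (simp add: max_def)
    next
      case False
      then show ?thesis using S(2)[of "plane_norm_sq m x"] by (simp add: max_def)
    qed
  qed
qed

text \<open>
  In the cell of \<open>x\<close> the step function has the value of \<open>f\<close> at the corner of the cell, up to \<open>C / sqrt n\<close>, and
  the corner is within \<open>m / sqrt n\<close> of \<open>x\<close> in each coordinate. Where \<open>x\<close> and the corner both lie beyond the threshold
  \<open>S\<close>, both functions vanish, which confines the error to a fixed cube.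
\<close>

lemma step_function_pointwise:
  fixes a :: "(nat \<Rightarrow> nat) \<Rightarrow> real" and f :: "real \<Rightarrow> real"
  assumes m: "m > 0" and n: "real n \<ge> 1" "real n \<ge> S" "real n \<ge> (real m)\<^sup>2" and S: "S \<ge> 0"
    and L: "L \<ge> 0" "\<And>s t. s \<ge> 0 \<Longrightarrow> t \<ge> 0 \<Longrightarrow> \<bar>f s - f t\<bar> \<le> L * \<bar>s - t\<bar>"
    and f0: "\<And>s. s > S \<Longrightarrow> f s = 0"
    and a0: "\<And>k. k \<in> count_vectors m n \<Longrightarrow> plane_norm_sq m (lattice_point m n k) > S \<Longrightarrow> a k = 0"
    and a: "\<And>k. k \<in> count_vectors m n \<Longrightarrow>
        \<bar>a k - f (plane_norm_sq m (lattice_point m n k))\<bar> \<le> C / sqrt (real n)" and C: "C \<ge> 0"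
    and x: "x \<in> {1..<m} \<rightarrow>\<^sub>E UNIV"
  shows "\<bar>step_function m n a x - f (plane_norm_sq m x)\<bar>
    \<le> (C + L * (2 * (sqrt S + 2) * (real m + (real m)\<^sup>2) * real m)) / sqrt (real n)
       * indicator (\<Pi>\<^sub>E i\<in>{1..<m}. {- (sqrt S + 1)..sqrt S + 1}) x"
    (is "_ \<le> ?E * indicator ?Q x")
proof -
  define w where "w = sqrt (real n)"
  have n0: "n > 0" using n by (cases n) auto
  have w: "w \<ge> 1" using n by (simp add: w_def)
  have mw: "real m / w \<le> 1"
  proof -
    have "real m \<le> w" unfolding w_def using n by (intro real_le_rsqrt) auto
    then show ?thesis using w by simp
  qed
  have E0: "?E \<ge> 0" using C L S by (intro divide_nonneg_nonneg add_nonneg_nonneg mult_nonneg_nonneg) auto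
  have EQ0: "?E * indicator ?Q x \<ge> 0" by (intro mult_nonneg_nonneg E0) simp
  define k where "k = cell_index m n x"
  define y where "y = lattice_point m n k"
  show ?thesis
  proof (cases "k \<in> count_vectors m n \<and> x \<in> cell m n k")
    case False
    have "plane_norm_sq m x > S"
    proof (rule ccontr)
      assume "\<not> plane_norm_sq m x > S"
      then show False using in_own_cell[OF m n0 _ n(2) x] False by (simp add: k_def)
    qed
    then have "f (plane_norm_sq m x) = 0" by (rule f0)
    moreover have "step_function m n a x = 0"
      using False unfolding step_function_eq[OF m n0] k_def by auto
    ultimately show ?thesis using EQ0 by (simp only: diff_0_right abs_zero)
  next
    case True
    then have F: "step_function m n a x = a k" by (simp add: step_function_eq[OF m n0] k_def)
    have xy: "\<bar>x i - y i\<bar> \<le> real m / w" if i: "i \<in> {1..<m}" for i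
      using True i by (auto simp: cell_def y_def w_def PiE_def Pi_def abs_le_iff)
    show ?thesis
    proof (cases "plane_norm_sq m x \<le> S \<or> plane_norm_sq m y \<le> S")
      case False
      then have "f (plane_norm_sq m x) = 0" "a k = 0"
        using f0[of "plane_norm_sq m x"] a0[of k] True by (auto simp: y_def)
      then show ?thesis using EQ0 F by (simp only: diff_0_right abs_zero)
    next
      case near: True
      have xb: "\<bar>x i\<bar> \<le> sqrt S + 1" and yb: "\<bar>y i\<bar> \<le> sqrt S + 2" if i: "i \<in> {1..<m}" for i
      proof -
        from near have "\<bar>x i\<bar> \<le> sqrt S \<or> \<bar>y i\<bar> \<le> sqrt S"
          using abs_coord_le_plane_norm[OF i, of x] abs_coord_le_plane_norm[OF i, of y]
            real_sqrt_le_mono[of "plane_norm_sq m x" S] real_sqrt_le_mono[of "plane_norm_sq m y" S] by linarith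
        then show "\<bar>x i\<bar> \<le> sqrt S + 1" "\<bar>y i\<bar> \<le> sqrt S + 2" using xy[OF i] mw by linarith+
      qed
      have "- (sqrt S + 1) \<le> x i \<and> x i \<le> sqrt S + 1" if "i \<in> {1..<m}" for i
        using xb[OF that] by linarith
      then have Q: "x \<in> ?Q" using x unfolding PiE_def Pi_def by auto
      have "\<bar>plane_norm_sq m x - plane_norm_sq m y\<bar> \<le> 2 * (sqrt S + 2) * (real m + (real m)\<^sup>2) * (real m / w)"
        using xb yb xy w S by (intro plane_norm_sq_lipschitz) fastforce+
      then have "L * \<bar>plane_norm_sq m y - plane_norm_sq m x\<bar> \<le> L * (2 * (sqrt S + 2) * (real m + (real m)\<^sup>2) * (real m / w))"
        using L by (intro mult_left_mono) (auto simp: abs_minus_commute)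
      moreover have "\<bar>f (plane_norm_sq m y) - f (plane_norm_sq m x)\<bar> \<le> L * \<bar>plane_norm_sq m y - plane_norm_sq m x\<bar>"
        by (intro L plane_norm_sq_nonneg)
      moreover have "\<bar>a k - f (plane_norm_sq m y)\<bar> \<le> C / w" using a True by (simp add: y_def w_def)
      moreover have "?E = C / w + L * (2 * (sqrt S + 2) * (real m + (real m)\<^sup>2) * (real m / w))"
        by (simp add: w_def add_divide_distrib)
      ultimately show ?thesis using Q F by simp
    qed
  qed
qed

theorem theorem2p1:
  fixes d :: nat and c :: real
  assumes "d \<ge> 1" and "c \<ge> 2 * real d"
  shows "(\<lambda>n. tv_dist d n (nat \<lfloor>c * real n\<rfloor>)
              - plane_integral (2 * d)
                  (closed_ball (2 * d) (radius d c) \<inter> zero_sum_plane (2 * d)) (gauss_diff d c))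
         \<in> O[inf sequentially (principal (admissible d c))](\<lambda>n. 1 / sqrt (real n))"
proof -
  define m where "m = 2 * d"
  define J where "J = {0..<m}"
  have m: "m > 0" using assms by (simp add: m_def)
  have c2: "c \<ge> 2" and c1: "c > 1" and cm: "c \<ge> real m" using assms by (auto simp: m_def)
  have J: "finite J" "J \<noteq> {}" and cJ: "card J = m" using m by (auto simp: J_def)
  define f where "f = (\<lambda>s. max (gauss_profile (real m) c s) 0)"
  obtain C S where C: "C \<ge> 0" and S: "S \<ge> 0" and g0: "\<And>s. s > S \<Longrightarrow> gauss_profile (real m) c s \<le> 0"
    and ev: "\<forall>\<^sub>F n in sequentially. \<forall>b K. sum b J = n \<longrightarrow> real m * real K = c * real n \<longrightarrow>
     (dispersion J b > S \<longrightarrow> hypergeom_mass K J b \<le> multinomial_mass J b) \<and>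
     \<bar>(sqrt (real n) / real m) ^ (m - 1) * max (hypergeom_mass K J b - multinomial_mass J b) 0
        - f (dispersion J b)\<bar> \<le> C / sqrt (real n)"
    using uniform_local_limit[OF J, of c] c2 cm unfolding cJ f_def by blast
  obtain L where L: "L \<ge> 0" and
    gL: "\<And>s t. s \<ge> 0 \<Longrightarrow> t \<ge> 0 \<Longrightarrow> \<bar>gauss_profile (real m) c s - gauss_profile (real m) c t\<bar> \<le> L * \<bar>s - t\<bar>"
    using gauss_profile_lipschitz[of "real m" c] m c1 by auto
  have fL: "\<bar>f s - f t\<bar> \<le> L * \<bar>s - t\<bar>" if "s \<ge> 0" "t \<ge> 0" for s t
    using gL[OF that] unfolding f_def by linarith
  have f0: "f s = 0" if "s > S" for s using g0[OF that] by (simp add: f_def)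
  define E where "E = C + L * (2 * (sqrt S + 2) * (real m + (real m)\<^sup>2) * real m)"
  define R where "R = sqrt S + 1"
  have R: "R \<ge> 0" using S by (simp add: R_def)
  define I where "I = (LINT x|lborel_coords m. f (plane_norm_sq m x))"
  have I: "plane_integral (2 * d) (closed_ball (2 * d) (radius d c) \<inter> zero_sum_plane (2 * d)) (gauss_diff d c) = I"
    unfolding plane_integral_eq_profile[OF assms(1) c1] I_def f_def m_def ..
  have large: "\<forall>\<^sub>F n in sequentially. real n \<ge> max 1 (max S ((real m)\<^sup>2))"
    by (rule eventually_compose_filterlim[OF eventually_ge_at_top filterlim_real_sequentially])
  have "\<forall>\<^sub>F n in sequentially. n \<in> admissible d c \<longrightarrow>
      \<bar>tv_dist d n (nat \<lfloor>c * real n\<rfloor>) - I\<bar> \<le> E * (2 * R) ^ (m - 1) * (1 / sqrt (real n))"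
    using ev large
  proof eventually_elim
    case (elim n)
    show ?case
    proof
      assume "n \<in> admissible d c"
      then obtain k :: int where n: "n > 0" and k: "c * real n = real_of_int k * real m"
        by (auto simp: admissible_def m_def)
      define K where "K = nat k"
      have "real_of_int k * real m > 0" using n c1 by (simp flip: k)
      then have "k > 0" using m by (simp add: zero_less_mult_iff)
      then have K: "real m * real K = c * real n" by (simp add: K_def k)
      then have N: "nat \<lfloor>c * real n\<rfloor> = m * K" by (simp flip: K of_nat_mult)
      have "real m * real n \<le> real m * real K" unfolding K using cm by (intro mult_right_mono) auto
      then have nK: "n \<le> K" using m by simp
      define T where "T = (\<lambda>k. max (hypergeom_mass K J (all_counts m n k) - multinomial_mass J (all_counts m n k)) 0)"
      \<comment> \<open>Excess masses divided by the volume of a cell.\<close>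
      define a where "a = (\<lambda>k. (sqrt (real n) / real m) ^ (m - 1) * T k)"
      define F where "F = step_function m n a"
      have disp: "dispersion J (all_counts m n k) = plane_norm_sq m (lattice_point m n k)"
        and tot: "sum (all_counts m n k) J = n" if "k \<in> count_vectors m n" for k
        using dispersion_all_counts[OF m n that] sum_all_counts_total[OF m that] by (auto simp: J_def)
      have a0: "a k = 0" if "k \<in> count_vectors m n" "plane_norm_sq m (lattice_point m n k) > S" for k
        using elim(1)[rule_format, OF tot[OF that(1)] K] that(2) disp[OF that(1)] by (simp add: a_def T_def)
      have ak: "\<bar>a k - f (plane_norm_sq m (lattice_point m n k))\<bar> \<le> C / sqrt (real n)"
        if "k \<in> count_vectors m n" for k
        using elim(1)[rule_format, OF tot[OF that] K] disp[OF that] by (simp add: a_def T_def)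
      have "tv_dist d n (nat \<lfloor>c * real n\<rfloor>) = (\<Sum>k\<in>count_vectors m n. T k)"
        unfolding N T_def J_def m_def using assms nK by (intro tv_dist_counts) auto
      also have "\<dots> = (\<Sum>k\<in>count_vectors m n. a k * (real m / sqrt (real n)) ^ (m - 1))"
        unfolding a_def using m n by (intro sum.cong refl) (simp add: power_divide)
      also have "\<dots> = (LINT x|lborel_coords m. F x)"
        unfolding F_def by (rule integral_step_function(2)[OF n, symmetric])
      finally have tv: "tv_dist d n (nat \<lfloor>c * real n\<rfloor>) = (LINT x|lborel_coords m. F x)" .
      have Fint: "integrable (lborel_coords m) F" unfolding F_def by (rule integral_step_function(1)[OF n])
      have fint: "integrable (lborel_coords m) (\<lambda>x. f (plane_norm_sq m x))"
        unfolding f_def by (rule integrable_profile[OF m c1 S g0])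
      have "tv_dist d n (nat \<lfloor>c * real n\<rfloor>) - I = (LINT x|lborel_coords m. F x - f (plane_norm_sq m x))"
        unfolding tv I_def by (rule Bochner_Integration.integral_diff[OF Fint fint, symmetric])
      also have "\<bar>\<dots>\<bar> \<le> (LINT x|lborel_coords m. \<bar>F x - f (plane_norm_sq m x)\<bar>)"
        by (rule integral_abs_bound)
      also have "\<dots> \<le> (LINT x|lborel_coords m. E / sqrt (real n) * indicator (\<Pi>\<^sub>E i\<in>{1..<m}. {- R..R}) x)"
      proof (rule integral_mono)
        show "integrable (lborel_coords m) (\<lambda>x. \<bar>F x - f (plane_norm_sq m x)\<bar>)"
          by (intro integrable_abs Bochner_Integration.integrable_diff Fint fint)
        show "integrable (lborel_coords m) (\<lambda>x. E / sqrt (real n) * indicator (\<Pi>\<^sub>E i\<in>{1..<m}. {- R..R}) x)"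
          by (rule integrable_cube_bound[OF R])
        fix x assume "x \<in> space (lborel_coords m)"
        then have x: "x \<in> {1..<m} \<rightarrow>\<^sub>E UNIV" by (simp add: space_PiM)
        show "\<bar>F x - f (plane_norm_sq m x)\<bar> \<le> E / sqrt (real n) * indicator (\<Pi>\<^sub>E i\<in>{1..<m}. {- R..R}) x"
          unfolding F_def E_def R_def
          by (rule step_function_pointwise[OF m _ _ _ S L fL f0 a0 ak C x]) (use elim(2) in auto)
      qed
      also have "\<dots> = E / sqrt (real n) * (2 * R) ^ (m - 1)" by (rule integrable_cube_bound[OF R])
      finally show "\<bar>tv_dist d n (nat \<lfloor>c * real n\<rfloor>) - I\<bar> \<le> E * (2 * R) ^ (m - 1) * (1 / sqrt (real n))"
        by simp
    qed
  qed
  then show ?thesis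
    unfolding I by (intro bigoI[where c = "E * (2 * R) ^ (m - 1)"]) (simp add: eventually_inf_principal)
qed

end
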